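(* Let $A$ be a first order sentence in the language of rooted trees. For $c>0$ let $f_A(c)=\Pr[T_c\models A]$, where $T_c$ is the Galton-Watson tree with Poisson($c$) offspring distribution. Then $f_A$ is a $C^\infty(0,\infty)$ function; that is, all derivatives of $f_A(c)$ exist and are continuous at all $c>0$.
   Context: The Galton-Watson tree $T_c$ with parameter $c>0$ is the random rooted tree in which each node, independently, has $Z$ children, where $Z$ has the Poisson distribution with mean $c$. (The tree may be finite or infinite.) The first order language of rooted trees has a constant symbol $R$ (the root), equality $v=w$, and the parent relation $\pi[v]=w$ ("$w$ is the parent of $v$", defined for $v\neq R$). Sentences are finite and made up from these using the usual Boolean connectives and existential and universal quantification over vertices. *)

theory Defs
  imports "HOL-Probability.Probability"
begin

datatype tree_term = Root | Var nat

text \<open>\<open>Parent s t\<close> stands for \<open>\<pi>[s] = t\<close>: the vertex \<open>t\<close> is the parent of the vertex \<open>s\<close>.\<close>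

datatype tree_formula =
    Equal tree_term tree_term
  | Parent tree_term tree_term
  | Neg tree_formula
  | Conj tree_formula tree_formula
  | Disj tree_formula tree_formula
  | Implies tree_formula tree_formula
  | Iff tree_formula tree_formula
  | Forall nat tree_formula
  | Exists nat tree_formula

primrec term_vars :: "tree_term \<Rightarrow> nat set" where
  "term_vars Root = {}"
| "term_vars (Var n) = {n}"

primrec free_vars :: "tree_formula \<Rightarrow> nat set" where
  "free_vars (Equal s t) = term_vars s \<union> term_vars t"
| "free_vars (Parent s t) = term_vars s \<union> term_vars t"
| "free_vars (Neg A) = free_vars A"
| "free_vars (Conj A B) = free_vars A \<union> free_vars B"
| "free_vars (Disj A B) = free_vars A \<union> free_vars B"
| "free_vars (Implies A B) = free_vars A \<union> free_vars B"
| "free_vars (Iff A B) = free_vars A \<union> free_vars B"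
| "free_vars (Forall n A) = free_vars A - {n}"
| "free_vars (Exists n A) = free_vars A - {n}"

definition sentence :: "tree_formula \<Rightarrow> bool" where
  "sentence A \<longleftrightarrow> free_vars A = {}"

primrec term_val :: "'v \<Rightarrow> (nat \<Rightarrow> 'v) \<Rightarrow> tree_term \<Rightarrow> 'v" where
  "term_val r e Root = r"
| "term_val r e (Var n) = e n"

text \<open>
  Satisfaction in the structure with universe \<open>V\<close>, root \<open>r\<close> and parent relation \<open>p\<close>, where
  \<open>p v w\<close> says that \<open>w\<close> is the parent of \<open>v\<close>. The relation \<open>p\<close> holds for no pair whose first
  component is the root, so an atom \<open>\<pi>[s] = t\<close> is false when \<open>s\<close> denotes the root.
\<close>

primrec sat :: "'v set \<Rightarrow> 'v \<Rightarrow> ('v \<Rightarrow> 'v \<Rightarrow> bool) \<Rightarrow> (nat \<Rightarrow> 'v) \<Rightarrow> tree_formula \<Rightarrow> bool" where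
  "sat V r p e (Equal s t) \<longleftrightarrow> term_val r e s = term_val r e t"
| "sat V r p e (Parent s t) \<longleftrightarrow> p (term_val r e s) (term_val r e t)"
| "sat V r p e (Neg A) \<longleftrightarrow> \<not> sat V r p e A"
| "sat V r p e (Conj A B) \<longleftrightarrow> sat V r p e A \<and> sat V r p e B"
| "sat V r p e (Disj A B) \<longleftrightarrow> sat V r p e A \<or> sat V r p e B"
| "sat V r p e (Implies A B) \<longleftrightarrow> (sat V r p e A \<longrightarrow> sat V r p e B)"
| "sat V r p e (Iff A B) \<longleftrightarrow> (sat V r p e A \<longleftrightarrow> sat V r p e B)"
| "sat V r p e (Forall n A) \<longleftrightarrow> (\<forall>v\<in>V. sat V r p (e(n := v)) A)"
| "sat V r p e (Exists n A) \<longleftrightarrow> (\<exists>v\<in>V. sat V r p (e(n := v)) A)"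

lemma sat_cong:
  assumes "\<And>n. n \<in> free_vars A \<Longrightarrow> e n = e' n"
  shows "sat V r p e A \<longleftrightarrow> sat V r p e' A"
  using assms
proof (induction A arbitrary: e e')
  case (Equal s t)
  then show ?case by (cases s; cases t) auto
next
  case (Parent s t)
  then show ?case by (cases s; cases t) auto
next
  case (Forall n A)
  have "sat V r p (e(n := v)) A \<longleftrightarrow> sat V r p (e'(n := v)) A" for v
    using Forall.prems by (intro Forall.IH) auto
  then show ?case by simp
next
  case (Exists n A)
  have "sat V r p (e(n := v)) A \<longleftrightarrow> sat V r p (e'(n := v)) A" for v
    using Exists.prems by (intro Exists.IH) auto
  then show ?case by simp
next
  case (Neg A)
  then show ?case by (metis free_vars.simps(3) sat.simps(3))
next
  case (Conj A B)
  then show ?case by (metis UnCI free_vars.simps(4) sat.simps(4))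
next
  case (Disj A B)
  then show ?case by (metis UnCI free_vars.simps(5) sat.simps(5))
next
  case (Implies A B)
  then show ?case by (metis UnCI free_vars.simps(6) sat.simps(6))
next
  case (Iff A B)
  then show ?case by (metis UnCI free_vars.simps(7) sat.simps(7))
qed

text \<open>
  The assignment below is immaterial for sentences, by \<open>sat_cong\<close>.
\<close>

definition models :: "'v set \<Rightarrow> 'v \<Rightarrow> ('v \<Rightarrow> 'v \<Rightarrow> bool) \<Rightarrow> tree_formula \<Rightarrow> bool" where
  "models V r p A \<longleftrightarrow> sat V r p (\<lambda>_. r) A"

text \<open>
  Vertices are encoded as lists of natural numbers (Ulam--Harris labels, the last step first):
  the root is \<open>[]\<close> and \<open>i # v\<close> is the child number \<open>i\<close> of \<open>v\<close>. An outcome \<open>z\<close> gives a number of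
  children to every label, and \<open>gw_verts z\<close> is the set of the labels that occur in the resulting
  tree; the values of \<open>z\<close> at other labels play no role.
\<close>

primrec in_tree :: "(nat list \<Rightarrow> nat) \<Rightarrow> nat list \<Rightarrow> bool" where
  "in_tree z [] \<longleftrightarrow> True"
| "in_tree z (i # v) \<longleftrightarrow> in_tree z v \<and> i < z v"

definition gw_verts :: "(nat list \<Rightarrow> nat) \<Rightarrow> nat list set" where
  "gw_verts z = {v. in_tree z v}"

definition parent_of :: "nat list \<Rightarrow> nat list \<Rightarrow> bool" where
  "parent_of v w \<longleftrightarrow> (\<exists>i. v = i # w)"

definition gw_models :: "(nat list \<Rightarrow> nat) \<Rightarrow> tree_formula \<Rightarrow> bool" where
  "gw_models z A \<longleftrightarrow> models (gw_verts z) [] parent_of A"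

definition gw_space :: "real \<Rightarrow> (nat list \<Rightarrow> nat) measure" where
  "gw_space c = (\<Pi>\<^sub>M v\<in>UNIV. measure_pmf (poisson_pmf c))"

definition gw_prob :: "tree_formula \<Rightarrow> real \<Rightarrow> real" where
  "gw_prob A c = \<P>(z in gw_space c. gw_models z A)"

lemma prob_space_gw_space: "prob_space (gw_space c)"
  unfolding gw_space_def by (intro prob_space_PiM) (rule measure_pmf.prob_space_axioms)

lemma gw_child_count_measurable [measurable]:
  "(\<lambda>z. z v) \<in> measurable (gw_space c) (count_space UNIV)"
proof -
  have "(\<lambda>z. z v) \<in> measurable (gw_space c) (measure_pmf (poisson_pmf c))"
    unfolding gw_space_def by (rule measurable_component_singleton) simp
  then show ?thesis by simp
qed

lemma in_tree_measurable [measurable]: "Measurable.pred (gw_space c) (\<lambda>z. in_tree z v)"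
  by (induction v) simp_all

text \<open>The probability in \<open>gw_prob\<close> is that of a measurable event.\<close>

lemma gw_models_measurable: "{z \<in> space (gw_space c). gw_models z A} \<in> sets (gw_space c)"
proof -
  have [measurable]: "Measurable.pred (gw_space c) (\<lambda>z. sat (gw_verts z) [] parent_of e A)" for e
    by (induction A arbitrary: e) (simp_all add: gw_verts_def Ball_def Bex_def)
  show ?thesis unfolding gw_models_def models_def by measurable
qed

end

theory Submission
  imports Defs "HOL-Complex_Analysis.Complex_Analysis"
begin

text \<open>
  Given a sentence \<open>A\<close>, a local Ehrenfeucht game provides a finite tree \<open>U\<close> and a depth \<open>d\<close> such that
  among the trees in which \<open>U\<close> occurs as the full subtree at some vertex, the truth of \<open>A\<close> depends
  only on the first \<open>d\<close> generations: \<open>U\<close> contains several copies of each of the finitely many types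
  of neighbourhoods away from the root. Almost surely a tree that avoids \<open>U\<close> is finite. Hence
  \<open>Pr[A]\<close> is the probability of an event on the first \<open>d\<close> generations, plus or minus probabilities of
  sets of finite trees that avoid \<open>U\<close>. A finite tree with \<open>n\<close> vertices has probability
  \<open>w (c e\<^sup>-\<^sup>c)\<^sup>n / c\<close> with \<open>w\<close> not depending on \<open>c\<close>, and \<open>c e\<^sup>-\<^sup>c \<le> e\<^sup>-\<^sup>1\<close>, while the generating function of
  the finite trees avoiding \<open>U\<close> has radius of convergence larger than \<open>e\<^sup>-\<^sup>1\<close>. So all terms
  extend holomorphically to a complex neighbourhood of the positive half-line.
\<close>

section \<open>Local Ehrenfeucht games on trees\<close>

text \<open>The obstacle is c = 1. There c e^(-c) equals e^(-1), the radius of convergence of the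
  generating function of all finite trees, and the probability that the tree is finite has a corner.
  The argument must therefore use that a first order sentence cannot single out the finite trees.
  The tree \<open>U\<close> achieves this: a copy of \<open>U\<close> hides from the sentence
  everything but the surroundings of the root, whether the tree is finite or not. Forbidding
  \<open>U\<close> removes the positive weight of \<open>U\<close> from the recursion for the
  avoiding trees, and this one defect is used twice. In the generating function it pushes the radius
  of convergence beyond e^(-1). In the fixed point equation for probabilities it leaves a single
  root that is at most 1, so that infinite trees avoiding \<open>U\<close> are negligible. The
  choice of \<open>U\<close> depends on the quantifier rank of the sentence and not on c, so one
  radius serves all c.\<close>

definition adj :: "(nat list \<times> nat list) set" where
  "adj = {(x, y). x = y \<or> parent_of x y \<or> parent_of y x}"

lemma adj_sym: "(x, y) \<in> adj \<longleftrightarrow> (y, x) \<in> adj"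
  by (auto simp: adj_def)

lemma adj_pow_sym: "(x, y) \<in> adj ^^ n \<longleftrightarrow> (y, x) \<in> adj ^^ n"
proof -
  have "(x, y) \<in> adj ^^ n \<Longrightarrow> (y, x) \<in> adj ^^ n" for x y
  proof (induction n arbitrary: y)
    case (Suc n)
    then obtain u where "(x, u) \<in> adj ^^ n" "(u, y) \<in> adj" by auto
    then show ?case using Suc.IH relpow_Suc_I2[of y u adj x n] adj_sym by blast
  qed simp
  then show ?thesis by blast
qed

text \<open>Because \<open>adj\<close> is reflexive, its n-th power means distance at most n, not a
  walk of exactly n proper steps.\<close>

lemma adj_pow_mono: "m \<le> n \<Longrightarrow> (x, y) \<in> adj ^^ m \<Longrightarrow> (x, y) \<in> adj ^^ n"
proof (induction n rule: dec_induct)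
  case (step n)
  then have "(x, y) \<in> adj ^^ n" by simp
  moreover have "(y, y) \<in> adj" by (simp add: adj_def)
  ultimately show ?case by (rule relpow_Suc_I)
qed

lemma adj_pow_trans: "(x, y) \<in> adj ^^ m \<Longrightarrow> (y, z) \<in> adj ^^ n \<Longrightarrow> (x, z) \<in> adj ^^ (m + n)"
  by (auto simp: relpow_add)

lemma adj_pow_double: "(x, y) \<in> adj ^^ (2 ^ j) \<Longrightarrow> (y, z) \<in> adj ^^ (2 ^ j) \<Longrightarrow> (x, z) \<in> adj ^^ (2 ^ Suc j)"
  using adj_pow_trans[of x y "2^j" z "2^j"] by (simp add: mult_2)

lemma adj_append: "(x @ w, y @ w) \<in> adj \<longleftrightarrow> (x, y) \<in> adj"
proof -
  have "x @ w = i # y @ w \<longleftrightarrow> x = i # y" for x y :: "nat list" and i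
    by (metis append_Cons append_same_eq)
  then show ?thesis by (auto simp: adj_def parent_of_def)
qed

lemma adj_pow_append: "(x, y) \<in> adj ^^ n \<Longrightarrow> (x @ w, y @ w) \<in> adj ^^ n"
proof (induction n arbitrary: y)
  case (Suc n)
  then obtain u where "(x, u) \<in> adj ^^ n" "(u, y) \<in> adj" by auto
  then show ?case using Suc.IH[of u] adj_append[of u w y] by auto
qed simp

lemma adj_pow_length: "(x, y) \<in> adj ^^ n \<Longrightarrow> length y \<le> length x + n"
proof (induction n arbitrary: y)
  case (Suc n)
  then obtain u where "(x, u) \<in> adj ^^ n" "(u, y) \<in> adj" by auto
  then show ?case using Suc.IH[of u] by (auto simp: adj_def parent_of_def)
qed simp

lemma adj_pow_root: "([], y) \<in> adj ^^ length y"
proof (induction y)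
  case (Cons i y)
  moreover have "(y, i # y) \<in> adj" by (auto simp: adj_def parent_of_def)
  ultimately show ?case by auto
qed simp

text \<open>Labels have the last step first, so \<open>x @ w\<close> lies at depth
  \<open>length x\<close> below \<open>w\<close>. One step lowers this depth by at most one, so
  \<open>n\<close> steps cannot leave the subtree at \<open>w\<close>. The length bound in the
  conclusion carries this through the induction.\<close>

lemma adj_pow_suffix:
  "(x @ w, y) \<in> adj ^^ n \<Longrightarrow> n \<le> length x \<Longrightarrow>
    \<exists>y'. y = y' @ w \<and> (x, y') \<in> adj ^^ n \<and> length x \<le> length y' + n"
proof (induction n arbitrary: y)
  case 0
  then show ?case by auto
next
  case (Suc n)
  then obtain u where "(x @ w, u) \<in> adj ^^ n" and u: "(u, y) \<in> adj" by auto
  then obtain u' where u': "u = u' @ w" "(x, u') \<in> adj ^^ n" "length x \<le> length u' + n"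
    using Suc by fastforce
  have "u' \<noteq> []" using u'(3) Suc.prems(2) by auto
  then obtain a u'' where a: "u' = a # u''" by (cases u') auto
  have "\<exists>y'. y = y' @ w \<and> length u' \<le> length y' + 1"
    using u u'(1) a by (auto simp: adj_def parent_of_def)
  then obtain y' where y': "y = y' @ w" "length u' \<le> length y' + 1" by blast
  then have "(u', y') \<in> adj" using u u'(1) adj_append by blast
  then show ?case using y' u' by auto
qed

section \<open>The local game: combining and transporting strategies, counting types\<close>

definition near :: "nat \<Rightarrow> nat list set \<Rightarrow> nat list \<Rightarrow> bool" where
  "near n S x \<longleftrightarrow> (\<exists>a\<in>S. (a, x) \<in> adj ^^ n)"

text \<open>
  The local Ehrenfeucht game with \<open>j\<close> rounds, played on positions \<open>P\<close> that pair vertices of \<open>V\<close> with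
  vertices of \<open>W\<close>. With \<open>j\<close> rounds remaining, moves and replies have to stay within distance
  \<open>2 ^ (j - 1)\<close> of the vertices chosen before.
\<close>

primrec loc_equiv :: "nat \<Rightarrow> nat list set \<Rightarrow> nat list set \<Rightarrow> (nat list \<times> nat list) set \<Rightarrow> bool" where
  "loc_equiv 0 V W P \<longleftrightarrow> (\<forall>(a, b)\<in>P. \<forall>(a', b')\<in>P. (a = a' \<longleftrightarrow> b = b') \<and> (parent_of a a' \<longleftrightarrow> parent_of b b'))"
| "loc_equiv (Suc j) V W P \<longleftrightarrow> loc_equiv j V W P
     \<and> (\<forall>x\<in>V. near (2 ^ j) (fst ` P) x \<longrightarrow> (\<exists>y\<in>W. near (2 ^ j) (snd ` P) y \<and> loc_equiv j V W (insert (x, y) P)))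
     \<and> (\<forall>y\<in>W. near (2 ^ j) (snd ` P) y \<longrightarrow> (\<exists>x\<in>V. near (2 ^ j) (fst ` P) x \<and> loc_equiv j V W (insert (x, y) P)))"

lemma loc_equiv_sym: "loc_equiv j V W P \<Longrightarrow> loc_equiv j W V (P\<inverse>)"
proof (induction j arbitrary: P)
  case 0
  then show ?case by fastforce
next
  case (Suc j)
  have 1: "fst ` P\<inverse> = snd ` P" "snd ` P\<inverse> = fst ` P" by force+
  have 2: "insert (y, x) (P\<inverse>) = (insert (x, y) P)\<inverse>" for x y by auto
  show ?case using Suc unfolding loc_equiv.simps 1 2 by blast
qed

lemma loc_equiv_0: "loc_equiv j V W P \<Longrightarrow> loc_equiv 0 V W P"
  by (induction j) auto

lemma loc_equiv_0D:
  "loc_equiv 0 V W P \<Longrightarrow> (a, b) \<in> P \<Longrightarrow> (a', b') \<in> P \<Longrightarrow>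
    (a = a' \<longleftrightarrow> b = b') \<and> (parent_of a a' \<longleftrightarrow> parent_of b b')"
  by fastforce

lemma loc_equiv_0I:
  assumes "\<And>a b a' b'. (a, b) \<in> P \<Longrightarrow> (a', b') \<in> P \<Longrightarrow>
    (a = a' \<longleftrightarrow> b = b') \<and> (parent_of a a' \<longleftrightarrow> parent_of b b')"
  shows "loc_equiv 0 V W P"
  using assms by fastforce

text \<open>Positions that are far apart in both trees can be played independently. If the gap
  exceeds 2^(j+1), a move within 2^j of one part is still more than 2^j away from the other, which
  is the gap required for the remaining \<open>j\<close> rounds. This is what the halving of the
  radii is for.\<close>

lemma loc_equiv_Un:
  assumes "loc_equiv j V W P" "loc_equiv j V W Q"
    and "\<And>a. a \<in> fst ` P \<Longrightarrow> \<not> near (2 ^ j) (fst ` Q) a"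
    and "\<And>a. a \<in> snd ` P \<Longrightarrow> \<not> near (2 ^ j) (snd ` Q) a"
  shows "loc_equiv j V W (P \<union> Q)"
  using assms
proof (induction j arbitrary: P Q)
  case 0
  have far: "a \<noteq> c \<and> \<not> parent_of a c \<and> \<not> parent_of c a \<and> b \<noteq> d \<and> \<not> parent_of b d \<and> \<not> parent_of d b"
    if "(a, b) \<in> P" "(c, d) \<in> Q" for a b c d
  proof -
    have "a \<in> fst ` P" "b \<in> snd ` P" "c \<in> fst ` Q" "d \<in> snd ` Q" using that by force+
    then have "(c, a) \<notin> adj" "(d, b) \<notin> adj" using 0(3,4) by (auto simp: near_def)
    then show ?thesis by (auto simp: adj_def)
  qed
  have "(a = a' \<longleftrightarrow> b = b') \<and> (parent_of a a' \<longleftrightarrow> parent_of b b')"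
    if "(a, b) \<in> P \<union> Q" "(a', b') \<in> P \<union> Q" for a b a' b'
    using that unfolding Un_iff
  proof (elim disjE)
    assume "(a, b) \<in> P" "(a', b') \<in> P"
    from loc_equiv_0D[OF 0(1) this] show ?thesis .
  next
    assume "(a, b) \<in> Q" "(a', b') \<in> Q"
    from loc_equiv_0D[OF 0(2) this] show ?thesis .
  next
    assume "(a, b) \<in> P" "(a', b') \<in> Q"
    from far[OF this] show ?thesis by simp
  next
    assume "(a, b) \<in> Q" "(a', b') \<in> P"
    from far[OF this(2,1)] show ?thesis by auto
  qed
  then show ?case by (rule loc_equiv_0I)
next
  case (Suc j)
  have mono: "near (2 ^ j) S x \<Longrightarrow> near (2 ^ Suc j) S x" for S x
    using adj_pow_mono[of "2 ^ j" "2 ^ Suc j"] unfolding near_def by fastforce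
  have near_Un: "near n (S \<union> T) x \<longleftrightarrow> near n S x \<or> near n T x" for n S T x
    by (auto simp: near_def)
  have ins: "near n (insert a S) x \<longleftrightarrow> (a, x) \<in> adj ^^ n \<or> near n S x" for n a S x
    by (auto simp: near_def)
  have far3: "(x, c) \<notin> adj ^^ (2 ^ j)"
    if "near (2 ^ j) S x" "\<And>a. a \<in> S \<Longrightarrow> \<not> near (2 ^ Suc j) T a" "c \<in> T" for S T x c
  proof
    from that(1) obtain a where a: "a \<in> S" "(a, x) \<in> adj ^^ (2 ^ j)" by (auto simp: near_def)
    assume "(x, c) \<in> adj ^^ (2 ^ j)"
    then have "(a, c) \<in> adj ^^ (2 ^ Suc j)" by (rule adj_pow_double[OF a(2)])
    then have "(c, a) \<in> adj ^^ (2 ^ Suc j)" by (subst adj_pow_sym)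
    then show False using that(2)[OF a(1)] \<open>c \<in> T\<close> unfolding near_def by blast
  qed
  have far1: "\<not> near (2 ^ j) T x"
    if "near (2 ^ j) S x" "\<And>a. a \<in> S \<Longrightarrow> \<not> near (2 ^ Suc j) T a" for S T x
    using far3[OF that] adj_pow_sym unfolding near_def by blast
  have far': "\<not> near (2 ^ Suc j) (fst ` P) c" if "c \<in> fst ` Q" for c
    using Suc.prems(3) that by (metis adj_pow_sym near_def)
  have far'': "\<not> near (2 ^ Suc j) (snd ` P) c" if "c \<in> snd ` Q" for c
    using Suc.prems(4) that by (metis adj_pow_sym near_def)
  have extP: "loc_equiv j V W (insert (x, y) (P \<union> Q))"
    if "near (2 ^ j) (fst ` P) x" "near (2 ^ j) (snd ` P) y" "loc_equiv j V W (insert (x, y) P)" for x y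
  proof -
    have "loc_equiv j V W (insert (x, y) P \<union> Q)"
    proof (rule Suc.IH[OF that(3)])
      show "loc_equiv j V W Q" using Suc.prems by simp
      fix a
      show "a \<in> fst ` insert (x, y) P \<Longrightarrow> \<not> near (2 ^ j) (fst ` Q) a"
        using far1[OF that(1) Suc.prems(3)] Suc.prems(3)[of a] mono
        unfolding image_insert insert_iff fst_conv by blast
      show "a \<in> snd ` insert (x, y) P \<Longrightarrow> \<not> near (2 ^ j) (snd ` Q) a"
        using far1[OF that(2) Suc.prems(4)] Suc.prems(4)[of a] mono
        unfolding image_insert insert_iff snd_conv by blast
    qed
    then show ?thesis by simp
  qed
  have extQ: "loc_equiv j V W (insert (x, y) (P \<union> Q))"
    if "near (2 ^ j) (fst ` Q) x" "near (2 ^ j) (snd ` Q) y" "loc_equiv j V W (insert (x, y) Q)" for x y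
  proof -
    have "loc_equiv j V W (P \<union> insert (x, y) Q)"
    proof (rule Suc.IH[OF _ that(3)])
      show "loc_equiv j V W P" using Suc.prems by simp
      fix a
      show "a \<in> fst ` P \<Longrightarrow> \<not> near (2 ^ j) (fst ` insert (x, y) Q) a"
        using far3[OF that(1) far', of a] Suc.prems(3)[of a] mono
        unfolding image_insert ins fst_conv by blast
      show "a \<in> snd ` P \<Longrightarrow> \<not> near (2 ^ j) (snd ` insert (x, y) Q) a"
        using far3[OF that(2) far'', of a] Suc.prems(4)[of a] mono
        unfolding image_insert ins snd_conv by blast
    qed
    then show ?thesis by simp
  qed
  have "loc_equiv j V W (P \<union> Q)"
  proof (rule Suc.IH)
    fix a
    show "a \<in> fst ` P \<Longrightarrow> \<not> near (2 ^ j) (fst ` Q) a"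
      using Suc.prems(3) mono by blast
    show "a \<in> snd ` P \<Longrightarrow> \<not> near (2 ^ j) (snd ` Q) a"
      using Suc.prems(4) mono by blast
  qed (use Suc.prems in auto)
  moreover have "\<exists>y\<in>W. near (2 ^ j) (snd ` (P \<union> Q)) y \<and> loc_equiv j V W (insert (x, y) (P \<union> Q))"
    if x: "x \<in> V" and nr: "near (2 ^ j) (fst ` (P \<union> Q)) x" for x
    using nr[unfolded image_Un near_Un]
  proof
    assume n: "near (2 ^ j) (fst ` P) x"
    then obtain y where "y \<in> W" "near (2 ^ j) (snd ` P) y" "loc_equiv j V W (insert (x, y) P)"
      using Suc.prems(1) x by auto
    then show ?thesis using extP[OF n] by (auto simp: near_Un image_Un)
  next
    assume n: "near (2 ^ j) (fst ` Q) x"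
    then obtain y where "y \<in> W" "near (2 ^ j) (snd ` Q) y" "loc_equiv j V W (insert (x, y) Q)"
      using Suc.prems(2) x by auto
    then show ?thesis using extQ[OF n] by (auto simp: near_Un image_Un)
  qed
  moreover have "\<exists>x\<in>V. near (2 ^ j) (fst ` (P \<union> Q)) x \<and> loc_equiv j V W (insert (x, y) (P \<union> Q))"
    if y: "y \<in> W" and nr: "near (2 ^ j) (snd ` (P \<union> Q)) y" for y
    using nr[unfolded image_Un near_Un]
  proof
    assume n: "near (2 ^ j) (snd ` P) y"
    then obtain x where "x \<in> V" "near (2 ^ j) (fst ` P) x" "loc_equiv j V W (insert (x, y) P)"
      using Suc.prems(1) y by auto
    then show ?thesis using extP[OF _ n] by (auto simp: near_Un image_Un)
  next
    assume n: "near (2 ^ j) (snd ` Q) y"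
    then obtain x where "x \<in> V" "near (2 ^ j) (fst ` Q) x" "loc_equiv j V W (insert (x, y) Q)"
      using Suc.prems(2) y by auto
    then show ?thesis using extQ[OF _ n] by (auto simp: near_Un image_Un)
  qed
  ultimately show ?case by simp
qed

text \<open>The strategy is to copy \<open>u\<close> to \<open>u @ w\<close> and back. The radii of
  the \<open>j\<close> rounds add up to less than 2^j, so agreement of the trees within 2^j of
  \<open>S\<close> is enough, and a start at depth 2^j below \<open>w\<close> keeps the play inside
  the subtree at \<open>w\<close>. For \<open>w = []\<close> that subtree is everything, whence the
  alternative.\<close>

lemma loc_equiv_shift:
  assumes "\<And>s. s \<in> S \<Longrightarrow> w = [] \<or> 2 ^ j \<le> length s"
    and "\<And>u. near (2 ^ j) S u \<Longrightarrow> u \<in> V \<longleftrightarrow> u @ w \<in> W"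
  shows "loc_equiv j V W ((\<lambda>u. (u, u @ w)) ` S)"
  using assms
proof (induction j arbitrary: S)
  case 0
  have "x @ w = i # y @ w \<longleftrightarrow> x = i # y" for x y :: "nat list" and i
    by (metis append_Cons append_same_eq)
  then show ?case by (auto simp: parent_of_def)
next
  case (Suc j)
  let ?P = "(\<lambda>u. (u, u @ w)) ` S"
  have im: "fst ` ?P = S" "snd ` ?P = (\<lambda>u. u @ w) ` S" by (auto simp: image_image)
  have le: "(2::nat) ^ j \<le> 2 ^ Suc j" by simp
  have mono: "near (2 ^ j) S u \<Longrightarrow> near (2 ^ Suc j) S u" for u
    unfolding near_def using adj_pow_mono[OF le] by blast
  have 0: "loc_equiv j V W ?P"
  proof (rule Suc.IH)
    show "w = [] \<or> 2 ^ j \<le> length s" if "s \<in> S" for s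
      using Suc.prems(1)[OF that] le by linarith
  qed (use Suc.prems(2) mono in blast)
  have ext: "loc_equiv j V W (insert (x, x @ w) ?P)" if x: "near (2 ^ j) S x" for x
  proof -
    obtain s where s: "s \<in> S" "(s, x) \<in> adj ^^ (2 ^ j)" using x by (auto simp: near_def)
    have "loc_equiv j V W ((\<lambda>u. (u, u @ w)) ` insert x S)"
    proof (rule Suc.IH)
      fix t assume "t \<in> insert x S"
      moreover have "length s \<le> length x + 2 ^ j"
        using s(2) adj_pow_length adj_pow_sym by blast
      ultimately show "w = [] \<or> 2 ^ j \<le> length t" using Suc.prems(1)[of t] Suc.prems(1)[OF s(1)] by auto
    next
      fix u assume "near (2 ^ j) (insert x S) u"
      then have "(x, u) \<in> adj ^^ (2 ^ j) \<or> near (2 ^ j) S u" by (auto simp: near_def)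
      then have "near (2 ^ Suc j) S u"
        using adj_pow_double[OF s(2)] s(1) mono by (auto simp del: power_Suc simp: near_def)
      then show "u \<in> V \<longleftrightarrow> u @ w \<in> W" by (rule Suc.prems(2))
    qed
    then show ?thesis by simp
  qed
  have nearw: "near (2 ^ j) (snd ` ?P) (x @ w)" if "near (2 ^ j) S x" for x
    using that adj_pow_append unfolding im near_def by blast
  have 1: "\<exists>y\<in>W. near (2 ^ j) (snd ` ?P) y \<and> loc_equiv j V W (insert (x, y) ?P)"
    if "x \<in> V" "near (2 ^ j) (fst ` ?P) x" for x
    using ext[of x] nearw[of x] Suc.prems(2)[of x] that mono unfolding im by blast
  have 2: "\<exists>x\<in>V. near (2 ^ j) (fst ` ?P) x \<and> loc_equiv j V W (insert (x, y) ?P)"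
    if y: "y \<in> W" "near (2 ^ j) (snd ` ?P) y" for y
  proof -
    obtain s where s: "s \<in> S" "(s @ w, y) \<in> adj ^^ (2 ^ j)"
      using y unfolding im by (auto simp: near_def)
    obtain x where x: "y = x @ w" "(s, x) \<in> adj ^^ (2 ^ j)"
      using adj_pow_suffix[OF s(2)] s Suc.prems(1)[OF s(1)] le by (metis append_Nil2 order_trans)
    then have "near (2 ^ j) S x" using s by (auto simp: near_def)
    then show ?thesis using ext[of x] Suc.prems(2)[of x] mono y x(1) unfolding im by blast
  qed
  show ?case using 0 1 2 by simp
qed

text \<open>Here \<open>f V as\<close> numbers the j-type of the tuple \<open>as\<close> in
  \<open>V\<close>. At j = 0 the type is the pattern of equalities and parent relations. The next
  type is the present one together with the set of types of the extensions by a nearby vertex, and a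
  finite set of types has finitely many subsets. Extensions lengthen the tuple, so \<open>m\<close>
  varies in the induction; an injection into the naturals restores one type of codes at every
  level.\<close>

lemma loc_equiv_finite_index:
  "\<exists>f :: nat list set \<Rightarrow> nat list list \<Rightarrow> nat. finite {f V as |V as. length as = m} \<and>
     (\<forall>V W as bs. length as = m \<longrightarrow> length bs = m \<longrightarrow> (f V as = f W bs \<longleftrightarrow> loc_equiv j V W (set (zip as bs))))"
proof (induction j arbitrary: m)
  case 0
  define h :: "nat list list \<Rightarrow> (nat \<times> nat \<times> bool \<times> bool) set" where
    "h as = (\<lambda>(i, k). (i, k, as ! i = as ! k, parent_of (as ! i) (as ! k))) ` ({..<m} \<times> {..<m})" for as
  have "{h as |as. length as = m} \<subseteq> Pow ({..<m} \<times> {..<m} \<times> UNIV \<times> UNIV)"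
    unfolding h_def by auto
  then have fin: "finite {h as |as. length as = m}" by (rule finite_subset) simp
  then obtain g :: "_ \<Rightarrow> nat" where g: "inj_on g {h as |as. length as = m}"
    using finite_imp_inj_to_nat_seg[OF fin] by blast
  have *: "h as = h bs \<longleftrightarrow> loc_equiv 0 V W (set (zip as bs))" if "length as = m" "length bs = m" for V W as bs
  proof
    assume e: "h as = h bs"
    have eq: "(as ! i = as ! k \<longleftrightarrow> bs ! i = bs ! k) \<and> (parent_of (as ! i) (as ! k) \<longleftrightarrow> parent_of (bs ! i) (bs ! k))"
      if "i < m" "k < m" for i k
    proof -
      have "(i, k, as ! i = as ! k, parent_of (as ! i) (as ! k)) \<in> h bs"
        unfolding e[symmetric] unfolding h_def using that by (intro image_eqI[of _ _ "(i, k)"]) auto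
      then show ?thesis by (auto simp: h_def)
    qed
    show "loc_equiv 0 V W (set (zip as bs))"
      by (rule loc_equiv_0I) (use eq that in \<open>auto simp: set_zip\<close>)
  next
    assume "loc_equiv 0 V W (set (zip as bs))"
    then have eq: "(as ! i = as ! k \<longleftrightarrow> bs ! i = bs ! k) \<and> (parent_of (as ! i) (as ! k) \<longleftrightarrow> parent_of (bs ! i) (bs ! k))"
      if "i < m" "k < m" for i k
    proof -
      have "(as ! i, bs ! i) \<in> set (zip as bs)" "(as ! k, bs ! k) \<in> set (zip as bs)"
        using that \<open>length as = m\<close> \<open>length bs = m\<close> by (auto simp: set_zip)
      from loc_equiv_0D[OF \<open>loc_equiv 0 V W (set (zip as bs))\<close> this] show ?thesis .
    qed
    show "h as = h bs"
      unfolding h_def by (intro image_cong refl) (auto simp: eq)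
  qed
  show ?case
  proof (intro exI[of _ "\<lambda>V as. g (h as)"] conjI allI impI)
    have "{g (h as) |(V :: nat list set) as. length as = m} = g ` {h as |as. length as = m}" by auto
    then show "finite {g (h as) |(V :: nat list set) as. length as = m}" using fin by simp
    fix V W :: "nat list set" and as bs :: "nat list list" assume l: "length as = m" "length bs = m"
    then have "h as \<in> {h as |as. length as = m}" "h bs \<in> {h as |as. length as = m}" by blast+
    then have "g (h as) = g (h bs) \<longleftrightarrow> h as = h bs" by (rule inj_on_eq_iff[OF g])
    then show "g (h as) = g (h bs) \<longleftrightarrow> loc_equiv 0 V W (set (zip as bs))"
      by (simp only: *[OF l])
  qed
next
  case (Suc j)
  obtain f :: "nat list set \<Rightarrow> nat list list \<Rightarrow> nat" where
    f: "finite {f V as |V as. length as = m}"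
      "\<And>V W as bs. length as = m \<Longrightarrow> length bs = m \<Longrightarrow> (f V as = f W bs \<longleftrightarrow> loc_equiv j V W (set (zip as bs)))"
    using Suc.IH[of m] by blast
  obtain f' :: "nat list set \<Rightarrow> nat list list \<Rightarrow> nat" where
    f': "finite {f' V as |V as. length as = Suc m}"
      "\<And>V W as bs. length as = Suc m \<Longrightarrow> length bs = Suc m \<Longrightarrow> (f' V as = f' W bs \<longleftrightarrow> loc_equiv j V W (set (zip as bs)))"
    using Suc.IH[of "Suc m"] by blast
  define h where "h V as = (f V as, {f' V (x # as) |x. x \<in> V \<and> near (2 ^ j) (set as) x})" for V as
  have "{h V as |V as. length as = m} \<subseteq> {f V as |V as. length as = m} \<times> Pow {f' V as |V as. length as = Suc m}"
    unfolding h_def by fastforce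
  then have fin: "finite {h V as |V as. length as = m}" by (rule finite_subset) (use f f' in simp)
  then obtain g :: "_ \<Rightarrow> nat" where g: "inj_on g {h V as |V as. length as = m}"
    using finite_imp_inj_to_nat_seg[OF fin] by blast
  have *: "h V as = h W bs \<longleftrightarrow> loc_equiv (Suc j) V W (set (zip as bs))" if l: "length as = m" "length bs = m" for V W as bs
  proof -
    have im: "fst ` set (zip as bs) = set as" "snd ` set (zip as bs) = set bs"
      using l by (metis map_fst_zip set_map) (metis l map_snd_zip set_map)
    have "insert (x, y) (set (zip as bs)) = set (zip (x # as) (y # bs))" for x y by simp
    then have i: "loc_equiv j V W (insert (x, y) (set (zip as bs))) \<longleftrightarrow> f' V (x # as) = f' W (y # bs)" for x y
      using f'(2)[of "x # as" "y # bs" V W] l by (simp del: zip_Cons_Cons)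
    have sets: "{F x |x. x \<in> V \<and> N x} = {G y |y. y \<in> W \<and> M y} \<longleftrightarrow>
        (\<forall>x\<in>V. N x \<longrightarrow> (\<exists>y\<in>W. M y \<and> F x = G y)) \<and> (\<forall>y\<in>W. M y \<longrightarrow> (\<exists>x\<in>V. N x \<and> F x = G y))"
      for F G :: "nat list \<Rightarrow> nat" and N M
    proof -
      have "{F x |x. x \<in> V \<and> N x} \<subseteq> {G y |y. y \<in> W \<and> M y} \<longleftrightarrow>
        (\<forall>x\<in>V. N x \<longrightarrow> (\<exists>y\<in>W. M y \<and> F x = G y))" by blast
      moreover have "{G y |y. y \<in> W \<and> M y} \<subseteq> {F x |x. x \<in> V \<and> N x} \<longleftrightarrow>
        (\<forall>y\<in>W. M y \<longrightarrow> (\<exists>x\<in>V. N x \<and> F x = G y))"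
      proof (intro iffI ballI impI)
        fix y assume h: "{G y |y. y \<in> W \<and> M y} \<subseteq> {F x |x. x \<in> V \<and> N x}" "y \<in> W" "M y"
        then have "G y \<in> {F x |x. x \<in> V \<and> N x}" by blast
        then show "\<exists>x\<in>V. N x \<and> F x = G y" by force
      next
        assume "\<forall>y\<in>W. M y \<longrightarrow> (\<exists>x\<in>V. N x \<and> F x = G y)"
        then show "{G y |y. y \<in> W \<and> M y} \<subseteq> {F x |x. x \<in> V \<and> N x}" by force
      qed
      ultimately show ?thesis unfolding set_eq_subset by simp
    qed
    show ?thesis unfolding loc_equiv.simps im i h_def prod.inject f(2)[OF l] sets by simp
  qed
  show ?case
  proof (intro exI[of _ "\<lambda>V as. g (h V as)"] conjI allI impI)
    have "{g (h V as) |V as. length as = m} = g ` {h V as |V as. length as = m}" by blast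
    then show "finite {g (h V as) |V as. length as = m}" using fin by auto
    fix V W :: "nat list set" and as bs :: "nat list list" assume l: "length as = m" "length bs = m"
    then have "h V as \<in> {h V as |V as. length as = m}" "h W bs \<in> {h V as |V as. length as = m}" by blast+
    then have "g (h V as) = g (h W bs) \<longleftrightarrow> h V as = h W bs" by (rule inj_on_eq_iff[OF g])
    then show "g (h V as) = g (h W bs) \<longleftrightarrow> loc_equiv (Suc j) V W (set (zip as bs))"
      by (simp only: *[OF l])
  qed
qed

text \<open>
  In a good tree every move far from the position can be answered, whatever the position is: the
  \<open>K\<close> bounds the number of rounds and the number of vertices in the position.
\<close>

definition good :: "nat \<Rightarrow> nat list set \<Rightarrow> bool" where
  "good K V \<longleftrightarrow> (\<forall>j<K. \<forall>z a B. a \<in> gw_verts z \<longrightarrow> 2 ^ j < length a \<longrightarrow> finite B \<longrightarrow> card B < K \<longrightarrow>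
     (\<exists>b\<in>V. \<not> near (2 ^ j) B b \<and> loc_equiv j (gw_verts z) V {(a, b)}))"

section \<open>From the local game to the truth of formulas\<close>

primrec qrank :: "tree_formula \<Rightarrow> nat" where
  "qrank (Equal s t) = 0"
| "qrank (Parent s t) = 0"
| "qrank (Neg A) = qrank A"
| "qrank (Conj A B) = max (qrank A) (qrank B)"
| "qrank (Disj A B) = max (qrank A) (qrank B)"
| "qrank (Implies A B) = max (qrank A) (qrank B)"
| "qrank (Iff A B) = max (qrank A) (qrank B)"
| "qrank (Forall n A) = Suc (qrank A)"
| "qrank (Exists n A) = Suc (qrank A)"

text \<open>A near move is answered by the hypothesis on \<open>P\<close>. A far move is far from
  the root in particular, since the pair of roots belongs to \<open>P\<close>; so it is deep,
  goodness of the second tree supplies a vertex of the same type far from the whole position, and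
  the two positions combine.\<close>

lemma game_reply:
  assumes "good K (gw_verts z')" and P: "finite P" "card P + Suc j \<le> K" "([], []) \<in> P"
    and loc_equiv: "loc_equiv (Suc j) (gw_verts z) (gw_verts z') P" and x: "x \<in> gw_verts z"
  shows "\<exists>y\<in>gw_verts z'. loc_equiv j (gw_verts z) (gw_verts z') (insert (x, y) P)"
proof (cases "near (2 ^ j) (fst ` P) x")
  case True
  then show ?thesis using loc_equiv x by auto
next
  case far: False
  have "[] \<in> fst ` P" using P(3) by force
  with far have nx: "([], x) \<notin> adj ^^ (2 ^ j)" by (auto simp: near_def)
  have "2 ^ j < length x"
  proof (rule ccontr)
    assume "\<not> 2 ^ j < length x"
    then have "length x \<le> 2 ^ j" by simp
    from adj_pow_mono[OF this adj_pow_root] nx show False by simp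
  qed
  moreover have "card (snd ` P) < K" using card_image_le[OF P(1), of snd] P(2) by linarith
  moreover have "j < K" "finite (snd ` P)" using P by auto
  ultimately obtain y where y: "y \<in> gw_verts z'" "\<not> near (2 ^ j) (snd ` P) y"
      "loc_equiv j (gw_verts z) (gw_verts z') {(x, y)}"
    using assms(1) x unfolding good_def by blast
  have "loc_equiv j (gw_verts z) (gw_verts z') ({(x, y)} \<union> P)"
    by (rule loc_equiv_Un[OF y(3)]) (use loc_equiv far y(2) in auto)
  then show ?thesis using y(1) by auto
qed

text \<open>Each quantifier uses up a round and adds at most one pair, so \<open>card P + j\<close>
  does not grow. Pairs of overwritten variables remain in \<open>P\<close>, which therefore contains
  the assignments instead of being equal to them. Goodness is required of both trees because a move
  may be made in either.\<close>

lemma sat_game: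
  assumes "good K (gw_verts z)" "good K (gw_verts z')"
    and "finite P" "card P + j \<le> K" "([], []) \<in> P" "loc_equiv j (gw_verts z) (gw_verts z') P"
    and "\<And>n. (e n, e' n) \<in> P" "qrank A \<le> j"
  shows "sat (gw_verts z) [] parent_of e A \<longleftrightarrow> sat (gw_verts z') [] parent_of e' A"
  using assms(3-)
proof (induction A arbitrary: e e' j P)
  case (Equal s t)
  then have "(term_val [] e s, term_val [] e' s) \<in> P" "(term_val [] e t, term_val [] e' t) \<in> P"
    by (cases s; simp) (cases t; use Equal in simp)
  from loc_equiv_0D[OF loc_equiv_0[OF Equal.prems(4)] this] show ?case by simp
next
  case (Parent s t)
  then have "(term_val [] e s, term_val [] e' s) \<in> P" "(term_val [] e t, term_val [] e' t) \<in> P"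
    by (cases s; simp) (cases t; use Parent in simp)
  from loc_equiv_0D[OF loc_equiv_0[OF Parent.prems(4)] this] show ?case by simp
next
  case (Neg A)
  have "sat (gw_verts z) [] parent_of e A \<longleftrightarrow> sat (gw_verts z') [] parent_of e' A"
    by (rule Neg.IH[of P j]) (use Neg.prems in auto)
  then show ?case by simp
next
  case (Conj A B)
  have "sat (gw_verts z) [] parent_of e A \<longleftrightarrow> sat (gw_verts z') [] parent_of e' A"
    by (rule Conj.IH(1)[of P j]) (use Conj.prems in auto)
  moreover have "sat (gw_verts z) [] parent_of e B \<longleftrightarrow> sat (gw_verts z') [] parent_of e' B"
    by (rule Conj.IH(2)[of P j]) (use Conj.prems in auto)
  ultimately show ?case by simp
next
  case (Disj A B)
  have "sat (gw_verts z) [] parent_of e A \<longleftrightarrow> sat (gw_verts z') [] parent_of e' A"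
    by (rule Disj.IH(1)[of P j]) (use Disj.prems in auto)
  moreover have "sat (gw_verts z) [] parent_of e B \<longleftrightarrow> sat (gw_verts z') [] parent_of e' B"
    by (rule Disj.IH(2)[of P j]) (use Disj.prems in auto)
  ultimately show ?case by simp
next
  case (Implies A B)
  have "sat (gw_verts z) [] parent_of e A \<longleftrightarrow> sat (gw_verts z') [] parent_of e' A"
    by (rule Implies.IH(1)[of P j]) (use Implies.prems in auto)
  moreover have "sat (gw_verts z) [] parent_of e B \<longleftrightarrow> sat (gw_verts z') [] parent_of e' B"
    by (rule Implies.IH(2)[of P j]) (use Implies.prems in auto)
  ultimately show ?case by simp
next
  case (Iff A B)
  have "sat (gw_verts z) [] parent_of e A \<longleftrightarrow> sat (gw_verts z') [] parent_of e' A"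
    by (rule Iff.IH(1)[of P j]) (use Iff.prems in auto)
  moreover have "sat (gw_verts z) [] parent_of e B \<longleftrightarrow> sat (gw_verts z') [] parent_of e' B"
    by (rule Iff.IH(2)[of P j]) (use Iff.prems in auto)
  ultimately show ?case by simp
next
  case (Forall n A)
  then obtain i where j: "j = Suc i" by (cases j) auto
  have step: "sat (gw_verts z) [] parent_of (e(n := x)) A \<longleftrightarrow> sat (gw_verts z') [] parent_of (e'(n := y)) A"
    if "loc_equiv i (gw_verts z) (gw_verts z') (insert (x, y) P)" for x y
    by (rule Forall.IH[OF _ _ _ that])
       (use Forall.prems j in \<open>auto simp: card_insert_if\<close>)
  note r1 = game_reply[OF assms(2) Forall.prems(1) Forall.prems(2)[unfolded j] Forall.prems(3) Forall.prems(4)[unfolded j]]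
  have r2: "\<exists>x\<in>gw_verts z. loc_equiv i (gw_verts z) (gw_verts z') (insert (x, y) P)" if "y \<in> gw_verts z'" for y
  proof -
    have "\<exists>x\<in>gw_verts z. loc_equiv i (gw_verts z') (gw_verts z) (insert (y, x) (P\<inverse>))"
      by (rule game_reply[OF assms(1) _ _ _ loc_equiv_sym[OF Forall.prems(4)[unfolded j]] that])
         (use Forall.prems j in \<open>auto simp: card_inverse\<close>)
    then obtain x where x: "x \<in> gw_verts z" "loc_equiv i (gw_verts z') (gw_verts z) (insert (y, x) (P\<inverse>))"
      by blast
    have "(insert (y, x) (P\<inverse>))\<inverse> = insert (x, y) P" by auto
    with x loc_equiv_sym[OF x(2)] show ?thesis by auto
  qed
  show ?case unfolding sat.simps using step r1 r2 by blast
next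
  case (Exists n A)
  then obtain i where j: "j = Suc i" by (cases j) auto
  have step: "sat (gw_verts z) [] parent_of (e(n := x)) A \<longleftrightarrow> sat (gw_verts z') [] parent_of (e'(n := y)) A"
    if "loc_equiv i (gw_verts z) (gw_verts z') (insert (x, y) P)" for x y
    by (rule Exists.IH[OF _ _ _ that])
       (use Exists.prems j in \<open>auto simp: card_insert_if\<close>)
  note r1 = game_reply[OF assms(2) Exists.prems(1) Exists.prems(2)[unfolded j] Exists.prems(3) Exists.prems(4)[unfolded j]]
  have r2: "\<exists>x\<in>gw_verts z. loc_equiv i (gw_verts z) (gw_verts z') (insert (x, y) P)" if "y \<in> gw_verts z'" for y
  proof -
    have "\<exists>x\<in>gw_verts z. loc_equiv i (gw_verts z') (gw_verts z) (insert (y, x) (P\<inverse>))"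
      by (rule game_reply[OF assms(1) _ _ _ loc_equiv_sym[OF Exists.prems(4)[unfolded j]] that])
         (use Exists.prems j in \<open>auto simp: card_inverse\<close>)
    then obtain x where x: "x \<in> gw_verts z" "loc_equiv i (gw_verts z') (gw_verts z) (insert (y, x) (P\<inverse>))"
      by blast
    have "(insert (y, x) (P\<inverse>))\<inverse> = insert (x, y) P" by auto
    with x loc_equiv_sym[OF x(2)] show ?thesis by auto
  qed
  show ?case unfolding sat.simps using step r1 r2 by blast
qed

section \<open>Finite trees and universal trees\<close>

datatype tree = Node (kids: "tree list")

lemma size_nth_less [termination_simp]:
  "i < length ts \<Longrightarrow> size (ts ! i) < Suc (size_list size (ts :: tree list))"
  using size_list_estimation'[of "ts ! i" ts "size (ts ! i)" size] by (simp add: less_Suc_eq_le)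

text \<open>The first step away from the root is the last entry of a label, so labels relative to
  child \<open>i\<close> of the root are extended by \<open>[i]\<close> on the right.\<close>

definition branch :: "nat \<Rightarrow> (nat list \<Rightarrow> nat) \<Rightarrow> nat list \<Rightarrow> nat" where
  "branch i z = (\<lambda>u. z (u @ [i]))"

definition subtree :: "nat list \<Rightarrow> (nat list \<Rightarrow> nat) \<Rightarrow> nat list \<Rightarrow> nat" where
  "subtree w z = (\<lambda>u. z (u @ w))"

lemma subtree_Nil [simp]: "subtree [] z = z"
  by (simp add: subtree_def)

lemma subtree_snoc: "subtree (w @ [i]) z = subtree w (branch i z)"
  by (simp add: subtree_def branch_def)

lemma branch_subtree: "branch i (subtree w z) = subtree (i # w) z"
  by (simp add: subtree_def branch_def)

lemma in_tree_append: "in_tree z (u @ w) \<longleftrightarrow> in_tree z w \<and> in_tree (subtree w z) u"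
  by (induction u) (auto simp: subtree_def)

lemma in_tree_snoc: "in_tree z (u @ [i]) \<longleftrightarrow> i < z [] \<and> in_tree (branch i z) u"
  by (simp add: in_tree_append subtree_def branch_def)

primrec trunc :: "nat \<Rightarrow> (nat list \<Rightarrow> nat) \<Rightarrow> tree" where
  "trunc 0 z = Node []"
| "trunc (Suc d) z = Node (map (\<lambda>i. trunc d (branch i z)) [0..<z []])"

fun matches :: "(nat list \<Rightarrow> nat) \<Rightarrow> tree \<Rightarrow> bool" where
  "matches z (Node ts) \<longleftrightarrow> z [] = length ts \<and> (\<forall>i<length ts. matches (branch i z) (ts ! i))"

lemma tree_induct [case_names Node]:
  assumes "\<And>ts. (\<And>i. i < length ts \<Longrightarrow> P (ts ! i)) \<Longrightarrow> P (Node ts)"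
  shows "P t"
proof (induction t)
  case (Node ts)
  then show ?case using assms by (metis nth_mem)
qed

lemma trunc_eq_in_tree:
  "trunc d z = trunc d z' \<Longrightarrow> length u \<le> d \<Longrightarrow> in_tree z u \<longleftrightarrow> in_tree z' u"
proof (induction d arbitrary: z z' u)
  case (Suc d)
  have l: "z [] = z' []" using arg_cong[OF Suc.prems(1), of "\<lambda>t. case t of Node ts \<Rightarrow> length ts"] by simp
  show ?case
  proof (cases u rule: rev_cases)
    case (snoc v i)
    have "trunc d (branch i z) = trunc d (branch i z')" if "i < z []"
      using Suc.prems(1) l that by (auto simp: map_eq_conv)
    then show ?thesis using Suc.IH[of "branch i z" "branch i z'" v] Suc.prems(2) l snoc by (auto simp: in_tree_snoc)
  qed simp
qed simp

lemma matches_trunc_in_tree: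
  "matches z (trunc d z') \<Longrightarrow> length u \<le> d \<Longrightarrow> in_tree z u \<longleftrightarrow> in_tree z' u"
proof (induction d arbitrary: z z' u)
  case (Suc d)
  show ?case
  proof (cases u rule: rev_cases)
    case (snoc v i)
    then show ?thesis using Suc.IH[of "branch i z" "branch i z'" v] Suc.prems by (auto simp: in_tree_snoc)
  qed simp
qed simp

lemma matches_eq_in_tree:
  "matches z t \<Longrightarrow> matches z' t \<Longrightarrow> in_tree z u \<longleftrightarrow> in_tree z' u"
proof (induction t arbitrary: z z' u rule: tree_induct)
  case (Node ts)
  show ?case
  proof (cases u rule: rev_cases)
    case (snoc v i)
    then show ?thesis using Node.IH[of i "branch i z" "branch i z'" v] Node.prems by (auto simp: in_tree_snoc)
  qed simp
qed

lemma matches_unique: "matches z t \<Longrightarrow> matches z t' \<Longrightarrow> t = t'"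
proof (induction t arbitrary: z t' rule: tree_induct)
  case (Node ts)
  obtain ts' where t': "t' = Node ts'" by (cases t')
  with Node show ?case by (auto intro!: nth_equalityI)
qed

section \<open>Occurrences of a fixed finite tree as a full subtree\<close>

definition has_copy :: "tree \<Rightarrow> (nat list \<Rightarrow> nat) \<Rightarrow> bool" where
  "has_copy U z \<longleftrightarrow> (\<exists>w. in_tree z w \<and> matches (subtree w z) U)"

lemma has_copy_rec: "has_copy U z \<longleftrightarrow> matches z U \<or> (\<exists>i<z []. has_copy U (branch i z))"
proof
  assume "has_copy U z"
  then obtain w where w: "in_tree z w" "matches (subtree w z) U" by (auto simp: has_copy_def)
  show "matches z U \<or> (\<exists>i<z []. has_copy U (branch i z))"
    using w by (cases w rule: rev_cases) (auto simp: has_copy_def in_tree_snoc subtree_snoc)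
next
  assume "matches z U \<or> (\<exists>i<z []. has_copy U (branch i z))"
  then show "has_copy U z"
  proof
    assume "matches z U"
    then have "in_tree z [] \<and> matches (subtree [] z) U" by simp
    then show ?thesis unfolding has_copy_def by blast
  next
    assume "\<exists>i<z []. has_copy U (branch i z)"
    then obtain i w where "in_tree z (w @ [i]) \<and> matches (subtree (w @ [i]) z) U"
      by (auto simp: has_copy_def in_tree_snoc subtree_snoc)
    then show ?thesis unfolding has_copy_def by blast
  qed
qed

fun avoids :: "tree \<Rightarrow> tree \<Rightarrow> bool" where
  "avoids U (Node ts) \<longleftrightarrow> Node ts \<noteq> U \<and> (\<forall>i<length ts. avoids U (ts ! i))"

lemma avoids_iff: "matches z t \<Longrightarrow> avoids U t \<longleftrightarrow> \<not> has_copy U z"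
proof (induction t arbitrary: z rule: tree_induct)
  case (Node ts)
  then have "avoids U (ts ! i) \<longleftrightarrow> \<not> has_copy U (branch i z)" if "i < length ts" for i
    using that by simp
  moreover have "Node ts = U \<longleftrightarrow> matches z U" using Node.prems matches_unique by blast
  ultimately show ?case using Node.prems has_copy_rec[of U z] by auto
qed

lemma avoids_smaller: "size t < size U \<Longrightarrow> avoids U t"
proof (induction t rule: tree_induct)
  case (Node ts)
  have "size (ts ! i) < size (Node ts)" if "i < length ts" for i
    using size_nth_less[OF that] by simp
  then show ?case using Node by fastforce
qed

text \<open>By size, \<open>U\<close> occurs in itself at the root only. Hence among the trees whose
  branches all avoid \<open>U\<close>, exactly \<open>U\<close> itself fails to avoid
  \<open>U\<close>; both the weight estimate and the probability recursion subtract just this one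
  tree.\<close>

lemma avoids_children: "U = Node us \<Longrightarrow> t \<in> set us \<Longrightarrow> avoids U t"
  using size_list_estimation'[of t us "size t" size] by (intro avoids_smaller) (simp add: less_Suc_eq_le)

lemma loc_equiv_root:
  assumes "trunc (2 ^ j) z = trunc (2 ^ j) z'"
  shows "loc_equiv j (gw_verts z) (gw_verts z') {([], [])}"
proof -
  have "loc_equiv j (gw_verts z) (gw_verts z') ((\<lambda>u. (u, u @ [])) ` {[]})"
  proof (rule loc_equiv_shift)
    fix u assume "near (2 ^ j) {[]} u"
    then have "length u \<le> 2 ^ j" using adj_pow_length[of "[]" u "2 ^ j"] by (auto simp: near_def)
    then show "u \<in> gw_verts z \<longleftrightarrow> u @ [] \<in> gw_verts z'"
      using trunc_eq_in_tree[OF assms] by (simp add: gw_verts_def)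
  qed simp
  then show ?thesis by simp
qed

text \<open>Types are compared across all trees at once and there are finitely many, so one
  representative for each type that occurs suffices.\<close>

lemma finite_deep_types:
  "\<exists>R :: ((nat list \<Rightarrow> nat) \<times> nat list) set. finite R \<and> R \<subseteq> {(z, a). a \<in> gw_verts z \<and> 2 ^ j < length a} \<and>
    (\<forall>z a. a \<in> gw_verts z \<longrightarrow> 2 ^ j < length a \<longrightarrow> (\<exists>(z', a')\<in>R. loc_equiv j (gw_verts z) (gw_verts z') {(a, a')}))"
proof -
  obtain f :: "nat list set \<Rightarrow> nat list list \<Rightarrow> nat" where f: "finite {f V as |V as. length as = 1}"
    "\<And>V W as bs. length as = 1 \<Longrightarrow> length bs = 1 \<Longrightarrow> f V as = f W bs \<longleftrightarrow> loc_equiv j V W (set (zip as bs))"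
    using loc_equiv_finite_index[of 1 j] by blast
  define D where "D = {(z :: nat list \<Rightarrow> nat, a). a \<in> gw_verts z \<and> 2 ^ j < length a}"
  define g where "g = (\<lambda>(z, a). f (gw_verts z) [a])"
  have "g p \<in> {f V as |V as. length as = 1}" for p
  proof -
    have "g p = f (gw_verts (fst p)) [snd p]" "length [snd p] = 1" by (auto simp: g_def split: prod.splits)
    then show ?thesis by blast
  qed
  then have "finite (g ` D)" by (intro finite_subset[OF _ f(1)] image_subsetI)
  then obtain R where R: "R \<subseteq> D" "finite R" "g ` D = g ` R"
    using finite_subset_image[of "g ` D" g D] by auto
  have "\<exists>(z', a')\<in>R. loc_equiv j (gw_verts z) (gw_verts z') {(a, a')}" if "(z, a) \<in> D" for z a
  proof -
    have "g (z, a) \<in> g ` R" using that R(3) by blast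
    then obtain z' a' where "(z', a') \<in> R" "g (z, a) = g (z', a')" by auto
    then show ?thesis using f(2)[of "[a]" "[a']" "gw_verts z" "gw_verts z'"] by (auto simp: g_def)
  qed
  then show ?thesis using R unfolding D_def by blast
qed

text \<open>Pigeonhole: the children \<open>i # w\<close> with \<open>i\<close> in \<open>I\<close>
  carry \<open>K\<close> copies of the surroundings of \<open>a\<close>. As \<open>a\<close> is
  deeper than 2^j, a vertex within 2^j of one copy lies below the same child, so each element of
  \<open>B\<close> spoils at most one copy, and \<open>B\<close> has fewer than \<open>K\<close>
  elements.\<close>

lemma good_copies:
  assumes "j < K" and a: "a \<in> gw_verts z" "2 ^ j < length a" and B: "finite B" "card B < K"
    and I: "card I = K" "\<And>i. i \<in> I \<Longrightarrow> i # w \<in> gw_verts x"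
      "\<And>i u. i \<in> I \<Longrightarrow> length u \<le> length a + 2 ^ j \<Longrightarrow> in_tree (subtree (i # w) x) u \<longleftrightarrow> in_tree z u"
  shows "\<exists>b\<in>gw_verts x. \<not> near (2 ^ j) B b \<and> loc_equiv j (gw_verts z) (gw_verts x) {(a, b)}"
proof -
  have mem: "u \<in> gw_verts z \<longleftrightarrow> u @ i # w \<in> gw_verts x" if "i \<in> I" "length u \<le> length a + 2 ^ j" for i u
    using I(2)[OF that(1)] I(3)[OF that] in_tree_append[of x u "i # w"] by (simp add: gw_verts_def)
  have loc_equiv: "loc_equiv j (gw_verts z) (gw_verts x) {(a, a @ i # w)}" if i: "i \<in> I" for i
  proof -
    have "loc_equiv j (gw_verts z) (gw_verts x) ((\<lambda>u. (u, u @ i # w)) ` {a})"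
    proof (rule loc_equiv_shift)
      fix u assume "near (2 ^ j) {a} u"
      then have "length u \<le> length a + 2 ^ j" using adj_pow_length[of a u "2 ^ j"] by (auto simp: near_def)
      then show "u \<in> gw_verts z \<longleftrightarrow> u @ i # w \<in> gw_verts x" using mem[OF i] by blast
    qed (use a in auto)
    then show ?thesis by simp
  qed
  have "\<exists>i\<in>I. \<not> near (2 ^ j) B (a @ i # w)"
  proof (rule ccontr)
    assume "\<not> (\<exists>i\<in>I. \<not> near (2 ^ j) B (a @ i # w))"
    then have "\<forall>i\<in>I. \<exists>y\<in>B. (y, a @ i # w) \<in> adj ^^ (2 ^ j)" by (auto simp: near_def)
    then obtain y where y: "\<And>i. i \<in> I \<Longrightarrow> y i \<in> B \<and> (y i, a @ i # w) \<in> adj ^^ (2 ^ j)" by metis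
    have suff: "\<exists>v. y i = v @ i # w" if "i \<in> I" for i
      using adj_pow_suffix[of a "i # w" "y i" "2 ^ j"] y[OF that] a adj_pow_sym by (metis less_imp_le)
    have "inj_on y I"
    proof (rule inj_onI)
      fix i k assume "i \<in> I" "k \<in> I" "y i = y k"
      then obtain v v' where "v @ i # w = v' @ k # w" using suff by metis
      then have "(v @ [i]) @ w = (v' @ [k]) @ w" by simp
      then have "v @ [i] = v' @ [k]" by (rule iffD1[OF append_same_eq])
      then show "i = k" by simp
    qed
    then have "K \<le> card B" using card_inj_on_le[of y I B] y B(1) I(1) by auto
    then show False using B(2) by simp
  qed
  then obtain i where i: "i \<in> I" "\<not> near (2 ^ j) B (a @ i # w)" by blast
  have "a @ i # w \<in> gw_verts x" using mem[OF i(1), of a] a by simp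
  then show ?thesis using i loc_equiv by blast
qed

text \<open>Equivalence is equality of type numbers, so transitivity comes without composing
  strategies.\<close>

lemma loc_equiv_trans_single:
  assumes "loc_equiv j V W {(a, b)}" "loc_equiv j W X {(b, c)}"
  shows "loc_equiv j V X {(a, c)}"
proof -
  obtain f :: "nat list set \<Rightarrow> nat list list \<Rightarrow> nat" where
    f: "\<And>V W as bs. length as = 1 \<Longrightarrow> length bs = 1 \<Longrightarrow> f V as = f W bs \<longleftrightarrow> loc_equiv j V W (set (zip as bs))"
    using loc_equiv_finite_index[of 1 j] by blast
  show ?thesis
    using assms f[of "[a]" "[b]" V W] f[of "[b]" "[c]" W X] f[of "[a]" "[c]" V X] by simp
qed

lemma universal_tree_exists: "\<exists>U. \<forall>x. has_copy U x \<longrightarrow> good K (gw_verts x)"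
proof -
  obtain R :: "nat \<Rightarrow> ((nat list \<Rightarrow> nat) \<times> nat list) set" where R:
    "\<And>j. finite (R j)" "\<And>j z a. (z, a) \<in> R j \<Longrightarrow> a \<in> gw_verts z \<and> 2 ^ j < length a"
    "\<And>j z a. a \<in> gw_verts z \<Longrightarrow> 2 ^ j < length a \<Longrightarrow> \<exists>(z', a')\<in>R j. loc_equiv j (gw_verts z) (gw_verts z') {(a, a')}"
  proof -
    have "\<forall>j. \<exists>R. finite R \<and> R \<subseteq> {(z, a). a \<in> gw_verts z \<and> 2 ^ j < length a} \<and>
      (\<forall>z a. a \<in> gw_verts z \<longrightarrow> 2 ^ j < length a \<longrightarrow> (\<exists>(z', a')\<in>R. loc_equiv j (gw_verts z) (gw_verts z') {(a, a')}))"
      using finite_deep_types by blast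
    from choice[OF this] obtain R where R0: "\<forall>j. finite (R j) \<and> R j \<subseteq> {(z, a). a \<in> gw_verts z \<and> 2 ^ j < length a} \<and>
      (\<forall>z a. a \<in> gw_verts z \<longrightarrow> 2 ^ j < length a \<longrightarrow> (\<exists>(z', a')\<in>R j. loc_equiv j (gw_verts z) (gw_verts z') {(a, a')}))"
      by (elim exE)
    show ?thesis
    proof (rule that[of R])
      show "finite (R j)" for j using spec[OF R0, of j] by simp
      show "a \<in> gw_verts z \<and> 2 ^ j < length a" if "(z, a) \<in> R j" for j z a
        using spec[OF R0, of j] that by auto
      show "\<exists>(z', a')\<in>R j. loc_equiv j (gw_verts z) (gw_verts z') {(a, a')}"
        if "a \<in> gw_verts z" "2 ^ j < length a" for j z a
        using spec[OF R0, of j] that by simp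
    qed
  qed
  obtain L where L: "set L = (\<Union>j<K. R j)" using finite_list[of "\<Union>j<K. R j"] R(1) by auto
  define n where "n = length L"
  \<comment> \<open>Deep enough that every representative is present together with its surroundings
    of radius 2^j, for all j < K.\<close>
  define D where "D = Max ((\<lambda>(z, a). length a) ` set L) + 2 ^ K"
  \<comment> \<open>Every representative gets \<open>K\<close> children of the root, namely those
    with the same index modulo \<open>n\<close>.\<close>
  define U where "U = Node (map (\<lambda>i. trunc D (fst (L ! (i mod n)))) [0..<n * K])"
  have "good K (gw_verts x)" if copy: "has_copy U x" for x
    unfolding good_def
  proof (intro allI impI)
    obtain w where w: "in_tree x w" "matches (subtree w x) U" using copy by (auto simp: has_copy_def)
    have xw: "x w = n * K" using w(2) by (simp add: U_def subtree_def)
    have ch: "matches (subtree (i # w) x) (trunc D (fst (L ! (i mod n))))" if "i < n * K" for i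
      using w(2) that by (simp add: U_def branch_subtree)
    fix j z a and B :: "nat list set"
    assume j: "j < K" and a: "a \<in> gw_verts z" "2 ^ j < length a" and B: "finite B" "card B < K"
    obtain z' a' where R': "(z', a') \<in> R j" "loc_equiv j (gw_verts z) (gw_verts z') {(a, a')}"
      using R(3)[OF a] by blast
    then have "(z', a') \<in> set L" using L j by auto
    then obtain l where l: "l < n" "L ! l = (z', a')" by (auto simp: n_def in_set_conv_nth)
    have "length a' \<le> Max ((\<lambda>(z, a). length a) ` set L)" using \<open>(z', a') \<in> set L\<close> by (intro Max_ge) force+
    moreover have "(2::nat) ^ j \<le> 2 ^ K" using j by (intro power_increasing) auto
    ultimately have D: "length a' + 2 ^ j \<le> D" unfolding D_def by linarith
    define I where "I = (\<lambda>m. l + n * m) ` {..<K}"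
    have I: "i < n * K" "i mod n = l" if i: "i \<in> I" for i
    proof -
      obtain m where m: "i = l + n * m" "m < K" using i by (auto simp: I_def)
      have "n * Suc m \<le> n * K" using m(2) by (intro mult_le_mono) auto
      then show "i < n * K" using m l by simp
      show "i mod n = l" using m l by simp
    qed
    have "\<exists>b\<in>gw_verts x. \<not> near (2 ^ j) B b \<and> loc_equiv j (gw_verts z') (gw_verts x) {(a', b)}"
    proof (rule good_copies[OF j _ _ B])
      show "a' \<in> gw_verts z'" "2 ^ j < length a'" using R(2)[OF R'(1)] by auto
      show "card I = K" unfolding I_def using l(1) by (subst card_image) (auto intro: inj_onI)
      fix i assume i: "i \<in> I"
      show "i # w \<in> gw_verts x" using I[OF i] w(1) xw by (simp add: gw_verts_def)
      fix u :: "nat list" assume "length u \<le> length a' + 2 ^ j"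
      then show "in_tree (subtree (i # w) x) u \<longleftrightarrow> in_tree z' u"
        using matches_trunc_in_tree[OF ch[OF I(1)[OF i]], of u] I(2)[OF i] l(2) D by simp
    qed
    then show "\<exists>b\<in>gw_verts x. \<not> near (2 ^ j) B b \<and> loc_equiv j (gw_verts z) (gw_verts x) {(a, b)}"
      using loc_equiv_trans_single[OF R'(2)] by blast
  qed
  then show ?thesis by blast
qed

lemma models_determined:
  "\<exists>U d. \<forall>z z'. has_copy U z \<longrightarrow> has_copy U z' \<longrightarrow> trunc d z = trunc d z' \<longrightarrow> gw_models z A = gw_models z' A"
proof -
  \<comment> \<open>The position holds one pair, that of the roots, before the
    \<open>qrank A\<close> rounds begin; this gives the bound \<open>Suc (qrank A)\<close>.\<close>
  obtain U where U: "\<And>x. has_copy U x \<Longrightarrow> good (Suc (qrank A)) (gw_verts x)" using universal_tree_exists by blast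
  have "gw_models z A = gw_models z' A"
    if "has_copy U z" "has_copy U z'" "trunc (2 ^ qrank A) z = trunc (2 ^ qrank A) z'" for z z'
    unfolding gw_models_def models_def
    by (rule sat_game[OF U U, where P = "{([], [])}" and j = "qrank A"]) (use that loc_equiv_root in auto)
  then show ?thesis by blast
qed

section \<open>Probabilities of finite trees\<close>

instance tree :: countable
  by countable_datatype

lemma space_gw_space [simp]: "space (gw_space c) = UNIV"
  by (simp add: gw_space_def space_PiM)

lemma coordinate_measurable:
  "i \<in> I \<Longrightarrow> (\<lambda>f. f i) \<in> PiM I (\<lambda>_. measure_pmf p) \<rightarrow>\<^sub>M count_space UNIV"
  using measurable_component_singleton[of i I "\<lambda>_. measure_pmf p"] by simp

lemma branch_measurable [measurable]: "branch i \<in> gw_space c \<rightarrow>\<^sub>M gw_space c"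
  unfolding gw_space_def branch_def
  by (rule measurable_PiM_single') (auto simp: space_PiM intro: coordinate_measurable)

lemma distr_branch: "distr (gw_space c) (gw_space c) (branch i) = gw_space c"
  using distr_PiM_reindex[of UNIV "\<lambda>_. measure_pmf (poisson_pmf c)" "\<lambda>u. u @ [i]" UNIV]
  by (simp add: gw_space_def branch_def[abs_def] measure_pmf.prob_space_axioms inj_def restrict_UNIV)

lemma prob_branch:
  assumes [measurable]: "Measurable.pred (gw_space c) E"
  shows "\<P>(z in gw_space c. E (branch i z)) = \<P>(z in gw_space c. E z)"
proof -
  have "\<P>(z in gw_space c. E z) = measure (distr (gw_space c) (gw_space c) (branch i)) {z. E z}"
    by (simp add: distr_branch)
  also have "\<dots> = \<P>(z in gw_space c. E (branch i z))"
    using predE[OF assms] by (subst measure_distr) (auto simp: vimage_def)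
  finally show ?thesis by simp
qed

lemma prob_root: "\<P>(z in gw_space c. z [] = n) = pmf (poisson_pmf c) n"
proof -
  have "measure (measure_pmf (poisson_pmf c)) {n} =
      measure (distr (gw_space c) (measure_pmf (poisson_pmf c)) (\<lambda>z. z [])) {n}"
    unfolding gw_space_def by (subst distr_PiM_component) (auto simp: measure_pmf.prob_space_axioms)
  also have "\<dots> = \<P>(z in gw_space c. z [] = n)"
    by (subst measure_distr) (auto simp: vimage_def)
  finally show ?thesis by (simp add: measure_pmf_single)
qed

lemma indep_vars_coordinates:
  "prob_space.indep_vars (gw_space c) (\<lambda>_. measure_pmf (poisson_pmf c)) (\<lambda>v z. z v) UNIV"
proof -
  interpret prob_space "gw_space c" by (rule prob_space_gw_space)
  have "(\<lambda>z. z v) \<in> gw_space c \<rightarrow>\<^sub>M measure_pmf (poisson_pmf c)" for v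
    unfolding gw_space_def by (rule measurable_component_singleton) simp
  moreover have "distr (gw_space c) (measure_pmf (poisson_pmf c)) (\<lambda>z. z v) = measure_pmf (poisson_pmf c)" for v
    unfolding gw_space_def by (rule distr_PiM_component) (auto simp: measure_pmf.prob_space_axioms)
  ultimately show ?thesis
    by (subst indep_vars_iff_distr_eq_PiM)
       (simp_all add: gw_space_def[symmetric] restrict_UNIV distr_id2 del: measurable_pmf_measure2)
qed

text \<open>The branching property: the number of children of the root and the different branches
  are read off disjoint sets of independent coordinates, and each branch is distributed like the
  whole tree.\<close>

lemma prob_root_branches:
  assumes E [measurable]: "\<And>i. Measurable.pred (gw_space c) (E i)"
  shows "\<P>(z in gw_space c. z [] = n \<and> (\<forall>i<n. E i (branch i z)))
    = pmf (poisson_pmf c) n * (\<Prod>i<n. \<P>(z in gw_space c. E i z))"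
proof -
  interpret prob_space "gw_space c" by (rule prob_space_gw_space)
  let ?M = "\<lambda>_ :: nat list. measure_pmf (poisson_pmf c)"
  \<comment> \<open>Block 0 is the root alone and block \<open>Suc i\<close> consists of the labels
    below child \<open>i\<close>, hence the shift of the index.\<close>
  define K :: "nat \<Rightarrow> nat list set" where
    "K j = (case j of 0 \<Rightarrow> {[]} | Suc i \<Rightarrow> range (\<lambda>u. u @ [i]))" for j
  define A where
    "A j = (case j of 0 \<Rightarrow> {f \<in> space (PiM (K 0) ?M). f [] = n}
      | Suc i \<Rightarrow> {f \<in> space (PiM (K (Suc i)) ?M). E i (\<lambda>u. f (u @ [i]))})" for j
  let ?X = "\<lambda>j z. restrict z (K j)"
  have ind: "indep_vars (\<lambda>j. PiM (K j) ?M) ?X UNIV"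
    by (rule indep_vars_restrict[OF indep_vars_coordinates])
       (auto simp: disjoint_family_on_def K_def split: nat.splits)
  have meas: "A j \<in> sets (PiM (K j) ?M)" for j
  proof (cases j)
    case 0
    have [measurable]: "(\<lambda>f. f []) \<in> PiM (K 0) ?M \<rightarrow>\<^sub>M count_space UNIV"
      by (rule coordinate_measurable) (simp add: K_def)
    show ?thesis unfolding A_def 0 nat.case by measurable
  next
    case (Suc i)
    have [measurable]: "(\<lambda>f u. f (u @ [i])) \<in> PiM (K (Suc i)) ?M \<rightarrow>\<^sub>M gw_space c"
      unfolding gw_space_def
      by (rule measurable_PiM_single') (auto simp: space_PiM K_def intro!: coordinate_measurable)
    show ?thesis unfolding A_def Suc nat.case by measurable
  qed
  have pre0: "?X 0 -` A 0 \<inter> space (gw_space c) = {z \<in> space (gw_space c). z [] = n}"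
    by (auto simp: A_def K_def space_PiM)
  have preS: "?X (Suc i) -` A (Suc i) \<inter> space (gw_space c) = {z \<in> space (gw_space c). E i (branch i z)}" for i
    by (auto simp: A_def K_def space_PiM branch_def)
  have "{z \<in> space (gw_space c). z [] = n \<and> (\<forall>i<n. E i (branch i z))} = (\<Inter>j\<in>{..<Suc n}. ?X j -` A j \<inter> space (gw_space c))"
    (is "?S = ?T")
  proof (rule set_eqI)
    fix z
    have "z \<in> ?T \<longleftrightarrow> (\<forall>j<Suc n. z \<in> ?X j -` A j \<inter> space (gw_space c))" by auto
    also have "\<dots> \<longleftrightarrow> z \<in> ?S" unfolding All_less_Suc2 pre0 preS by auto
    finally show "z \<in> ?S \<longleftrightarrow> z \<in> ?T" by simp
  qed
  also have "prob \<dots> = (\<Prod>j<Suc n. prob (?X j -` A j \<inter> space (gw_space c)))"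
    by (rule indep_varsD[OF ind]) (auto simp: meas)
  also have "\<dots> = prob {z \<in> space (gw_space c). z [] = n} * (\<Prod>i<n. prob {z \<in> space (gw_space c). E i (branch i z)})"
    unfolding prod.lessThan_Suc_shift pre0 preS ..
  also have "\<dots> = pmf (poisson_pmf c) n * (\<Prod>i<n. \<P>(z in gw_space c. E i z))"
    using prob_root[of c n] prob_branch[OF E] by simp
  finally show ?thesis .
qed

lemma matches_measurable [measurable]: "Measurable.pred (gw_space c) (\<lambda>z. matches z t)"
proof (induction t rule: tree_induct)
  case (Node ts)
  have "Measurable.pred (gw_space c) (\<lambda>z. matches (branch i z) (ts ! i))" if "i < length ts" for i
    using measurable_compose[OF branch_measurable Node.IH[OF that]] .
  then show ?case by simp
qed

lemma trunc_measurable [measurable]: "trunc d \<in> gw_space c \<rightarrow>\<^sub>M count_space UNIV"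
proof (induction d)
  case (Suc d)
  note [measurable] = Suc
  have *: "trunc (Suc d) z = Node (map (\<lambda>i. trunc d (branch i z)) [0..<z []])" for z by simp
  have 1: "Measurable.pred (gw_space c) (\<lambda>z. trunc (Suc d) z = t)" for t
  proof (cases t)
    case (Node ts)
    have "trunc (Suc d) z = t \<longleftrightarrow> z [] = length ts \<and> (\<forall>i<length ts. trunc d (branch i z) = ts ! i)" for z
      unfolding Node * by (auto simp: list_eq_iff_nth_eq)
    then show ?thesis by simp
  qed
  show ?case
    by (rule measurable_count_space_eq2_countable[THEN iffD2])
       (use 1 in \<open>auto simp: vimage_def pred_def\<close>)
qed simp

lemma has_copy_measurable [measurable]: "Measurable.pred (gw_space c) (has_copy U)"
proof -
  have [measurable]: "subtree w \<in> gw_space c \<rightarrow>\<^sub>M gw_space c" for w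
    unfolding gw_space_def subtree_def
    by (rule measurable_PiM_single') (auto simp: space_PiM intro: coordinate_measurable)
  show ?thesis unfolding has_copy_def[abs_def] by measurable
qed

text \<open>With q = c e^(-c) this is c times the probability of the tree. The extra factor c makes
  the recursion close up: in c e^(-c) c^n / n! the power c^n is distributed among the
  \<open>n\<close> children, and a constant times a power of q remains. The field is arbitrary so
  that q may be real or complex.\<close>

fun weight :: "'a :: field_char_0 \<Rightarrow> tree \<Rightarrow> 'a" where
  "weight q (Node ts) = q * (1 / fact (length ts) * (\<Prod>i<length ts. weight q (ts ! i)))"

text \<open>Intended for a = e^(-c) and x = c. The vertices at depth \<open>d\<close> contribute no
  offspring factor, so the result is not a function of c e^(-c) alone; keeping \<open>a\<close> and
  \<open>x\<close> apart lets both be replaced by real bounds.\<close>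

primrec trunc_weight :: "nat \<Rightarrow> 'a :: field_char_0 \<Rightarrow> 'a \<Rightarrow> tree \<Rightarrow> 'a" where
  "trunc_weight 0 a x t = (if t = Node [] then 1 else 0)"
| "trunc_weight (Suc d) a x t =
     a * (x ^ length (kids t) / fact (length (kids t)) * (\<Prod>i<length (kids t). trunc_weight d a x (kids t ! i)))"

lemma prob_matches:
  assumes "c > 0"
  shows "c * \<P>(z in gw_space c. matches z t) = weight (c * exp (- c)) t"
proof (induction t rule: tree_induct)
  case (Node ts)
  let ?n = "length ts"
  have "\<P>(z in gw_space c. matches z (Node ts))
      = pmf (poisson_pmf c) ?n * (\<Prod>i<?n. \<P>(z in gw_space c. matches z (ts ! i)))"
    using prob_root_branches[where c = c and n = ?n and E = "\<lambda>i z. matches z (ts ! i)"] by simp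
  moreover have "(\<Prod>i<?n. weight (c * exp (- c)) (ts ! i)) = (\<Prod>i<?n. c * \<P>(z in gw_space c. matches z (ts ! i)))"
    using Node by (intro prod.cong) auto
  ultimately show ?case using assms by (simp add: prod.distrib)
qed

lemma prob_trunc:
  assumes "c > 0"
  shows "\<P>(z in gw_space c. trunc d z = t) = trunc_weight d (exp (- c)) c t"
proof (induction d arbitrary: t)
  case 0
  interpret prob_space "gw_space c" by (rule prob_space_gw_space)
  show ?case using prob_space by auto
next
  case (Suc d)
  obtain ts where t: "t = Node ts" by (cases t)
  let ?n = "length ts"
  have "trunc (Suc d) z = t \<longleftrightarrow> z [] = ?n \<and> (\<forall>i<?n. trunc d (branch i z) = ts ! i)" for z
    by (auto simp: t list_eq_iff_nth_eq)
  then have "\<P>(z in gw_space c. trunc (Suc d) z = t)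
      = pmf (poisson_pmf c) ?n * (\<Prod>i<?n. \<P>(z in gw_space c. trunc d z = ts ! i))"
    using prob_root_branches[where c = c and n = ?n and E = "\<lambda>i z. trunc d z = ts ! i"] by simp
  then show ?case using assms by (simp add: Suc[simplified] t)
qed

lemma norm_weight: "norm (weight q t) = weight (norm q) t" for q :: "'a :: {real_normed_field, field_char_0}"
  by (induction t rule: tree_induct) (simp add: norm_mult norm_divide flip: prod_norm)

lemma weight_of_real: "weight (of_real q) t = (of_real (weight q t) :: 'a :: {real_field, field_char_0})"
  by (induction t rule: tree_induct) simp

lemma weight_nonneg: "0 \<le> q \<Longrightarrow> 0 \<le> weight (q :: real) t"
  by (induction t rule: tree_induct) (auto intro!: divide_nonneg_nonneg mult_nonneg_nonneg prod_nonneg)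

lemma weight_pos: "0 < q \<Longrightarrow> 0 < weight (q :: real) t"
  by (induction t rule: tree_induct) (auto intro!: divide_pos_pos mult_pos_pos prod_pos)

lemma weight_mono: "0 \<le> q \<Longrightarrow> q \<le> q' \<Longrightarrow> weight (q :: real) t \<le> weight q' t"
proof (induction t rule: tree_induct)
  case (Node ts)
  then have "(\<Prod>i<length ts. weight q (ts ! i)) \<le> (\<Prod>i<length ts. weight q' (ts ! i))"
    by (intro prod_mono) (auto intro: weight_nonneg)
  then show ?case using Node.prems unfolding weight.simps
    by (intro mult_mono) (auto intro!: prod_nonneg weight_nonneg divide_nonneg_nonneg)
qed

lemma isCont_weight [continuous_intros]: "isCont (\<lambda>q. weight (q :: 'a :: {real_normed_field, field_char_0}) t) x"
  by (induction t rule: tree_induct) (auto intro!: continuous_intros)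

lemma holomorphic_weight [holomorphic_intros]:
  "f holomorphic_on S \<Longrightarrow> (\<lambda>x. weight (f x) t) holomorphic_on S"
  by (induction t rule: tree_induct) (auto intro!: holomorphic_intros)

lemma trunc_weight_of_real:
  "trunc_weight d (of_real a) (of_real x) t = (of_real (trunc_weight d a x t) :: 'a :: {real_field, field_char_0})"
  by (induction d arbitrary: t) auto

lemma trunc_weight_nonneg: "0 \<le> a \<Longrightarrow> 0 \<le> x \<Longrightarrow> 0 \<le> trunc_weight d (a :: real) x t"
  by (induction d arbitrary: t) (auto intro!: divide_nonneg_nonneg mult_nonneg_nonneg prod_nonneg)

lemma norm_trunc_weight_le:
  fixes a x :: "'a :: {real_normed_field, field_char_0}"
  assumes "norm a \<le> a'" "norm x \<le> x'"
  shows "norm (trunc_weight d a x t) \<le> trunc_weight d a' x' t"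
proof (induction d arbitrary: t)
  case (Suc d)
  let ?n = "length (kids t)"
  have a': "0 \<le> a'" "0 \<le> x'" using assms norm_ge_zero order_trans by blast+
  have "(\<Prod>i<?n. norm (trunc_weight d a x (kids t ! i))) \<le> (\<Prod>i<?n. trunc_weight d a' x' (kids t ! i))"
    by (intro prod_mono) (auto simp: Suc)
  moreover have "norm x ^ ?n \<le> x' ^ ?n" using assms by (intro power_mono) auto
  ultimately show ?case using assms a' unfolding trunc_weight.simps norm_mult norm_divide norm_power norm_fact
    by (intro mult_mono divide_right_mono) (auto simp: prod_norm[symmetric] intro!: prod_nonneg trunc_weight_nonneg mult_nonneg_nonneg divide_nonneg_nonneg)
qed simp

lemma holomorphic_trunc_weight [holomorphic_intros]:
  "f holomorphic_on S \<Longrightarrow> g holomorphic_on S \<Longrightarrow> (\<lambda>x. trunc_weight d (f x) (g x) t) holomorphic_on S"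
  by (induction d arbitrary: t) (auto intro!: holomorphic_intros)

section \<open>Total weights of sets of trees\<close>

lemma sum_lists_prod:
  fixes \<phi> :: "'b \<Rightarrow> 'a :: comm_semiring_1"
  assumes "finite S"
  shows "(\<Sum>ts | set ts \<subseteq> S \<and> length ts = n. \<Prod>i<n. \<phi> (ts ! i)) = (\<Sum>t\<in>S. \<phi> t) ^ n"
proof (induction n)
  case 0
  have "{ts. set ts \<subseteq> S \<and> length ts = 0} = {[]}" by auto
  then show ?case by simp
next
  case (Suc n)
  let ?L = "{ts. set ts \<subseteq> S \<and> length ts = n}"
  have "{ts. set ts \<subseteq> S \<and> length ts = Suc n} = (\<lambda>(t, ts). t # ts) ` (S \<times> ?L)"
    by (auto simp: length_Suc_conv image_iff)
  then have "(\<Sum>ts | set ts \<subseteq> S \<and> length ts = Suc n. \<Prod>i<Suc n. \<phi> (ts ! i))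
      = (\<Sum>(t, ts)\<in>S \<times> ?L. \<Prod>i<Suc n. \<phi> ((t # ts) ! i))"
    by (simp add: sum.reindex inj_on_def case_prod_unfold del: prod.lessThan_Suc)
  also have "\<dots> = (\<Sum>(t, ts)\<in>S \<times> ?L. \<phi> t * (\<Prod>i<n. \<phi> (ts ! i)))"
    unfolding prod.lessThan_Suc_shift by simp
  also have "\<dots> = (\<Sum>t\<in>S. \<phi> t) ^ Suc n"
    by (simp add: sum.cartesian_product[symmetric] sum_product[symmetric] Suc)
  finally show ?case .
qed

text \<open>Group the lists by length and enlarge each group to all lists of that length over
  \<open>S\<close>: the products then sum to an n-th power, and what remains is a partial sum of the
  exponential series.\<close>

lemma sum_lists_le_exp:
  fixes \<phi> :: "'b \<Rightarrow> real"
  assumes "finite S" "finite L" "L \<subseteq> lists S" "\<And>t. t \<in> S \<Longrightarrow> 0 \<le> \<phi> t" "0 \<le> x"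
  shows "(\<Sum>ts\<in>L. x ^ length ts / fact (length ts) * (\<Prod>i<length ts. \<phi> (ts ! i))) \<le> exp (x * sum \<phi> S)"
    (is "sum ?f L \<le> _")
proof -
  have pos: "0 \<le> ?f ts" if "ts \<in> lists S" for ts
    using assms that by (intro mult_nonneg_nonneg divide_nonneg_nonneg prod_nonneg) auto
  have "sum ?f L = (\<Sum>n\<in>length ` L. sum ?f {ts \<in> L. length ts = n})"
    using assms by (intro sum.group[symmetric]) auto
  also have "\<dots> \<le> (\<Sum>n\<in>length ` L. sum ?f {ts. set ts \<subseteq> S \<and> length ts = n})"
    using assms(1,3) pos by (intro sum_mono sum_mono2 finite_lists_length_eq) auto
  also have "\<dots> = (\<Sum>n\<in>length ` L. (x * sum \<phi> S) ^ n / fact n)"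
  proof (rule sum.cong)
    fix n
    have "sum ?f {ts. set ts \<subseteq> S \<and> length ts = n}
        = x ^ n / fact n * (\<Sum>ts | set ts \<subseteq> S \<and> length ts = n. \<Prod>i<n. \<phi> (ts ! i))"
      unfolding sum_distrib_left by (intro sum.cong) auto
    then show "sum ?f {ts. set ts \<subseteq> S \<and> length ts = n} = (x * sum \<phi> S) ^ n / fact n"
      by (simp add: sum_lists_prod[OF assms(1)] power_mult_distrib)
  qed simp
  also have "\<dots> \<le> (\<Sum>n. (x * sum \<phi> S) ^ n / fact n)"
    using assms summable_exp_generic[of "x * sum \<phi> S"]
    by (intro sum_le_suminf) (auto intro!: divide_nonneg_nonneg zero_le_power mult_nonneg_nonneg sum_nonneg simp: divide_inverse mult.commute)
  also have "\<dots> = exp (x * sum \<phi> S)"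
    by (simp add: exp_def divide_inverse mult.commute)
  finally show ?thesis .
qed

lemma sum_kids: "finite T \<Longrightarrow> sum f T = (\<Sum>ts\<in>kids ` T. f (Node ts))"
proof -
  have "inj_on kids T" by (auto simp: inj_on_def intro: tree.expand)
  then show ?thesis by (simp add: sum.reindex)
qed

text \<open>One more generation turns a bound \<open>C\<close> into \<open>exp (x * C)\<close>.
  Bounded depth keeps this iterated exponential finite even with 1 in place of e^(-c), when the
  weights are no longer probabilities.\<close>

lemma sum_trunc_weight_bounded:
  assumes "0 \<le> x"
  shows "\<exists>C. \<forall>T. finite T \<longrightarrow> (\<Sum>t\<in>T. trunc_weight d 1 x t) \<le> (C :: real)"
proof (induction d)
  case 0
  have "(\<Sum>t\<in>T. trunc_weight 0 1 x t) \<le> 1" if "finite T" for T :: "tree set"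
    using that by (simp add: sum.delta')
  then show ?case by blast
next
  case (Suc d)
  then obtain C where C: "\<And>T. finite T \<Longrightarrow> (\<Sum>t\<in>T. trunc_weight d 1 x t) \<le> C" by blast
  have "(\<Sum>t\<in>T. trunc_weight (Suc d) 1 x t) \<le> exp (x * C)" if T: "finite T" for T
  proof -
    define S where "S = (\<Union>ts\<in>kids ` T. set ts)"
    have "(\<Sum>t\<in>T. trunc_weight (Suc d) 1 x t)
        = (\<Sum>ts\<in>kids ` T. x ^ length ts / fact (length ts) * (\<Prod>i<length ts. trunc_weight d 1 x (ts ! i)))"
      using T by (subst sum_kids) auto
    also have "\<dots> \<le> exp (x * sum (trunc_weight d 1 x) S)"
      using T assms by (intro sum_lists_le_exp trunc_weight_nonneg) (auto simp: S_def)
    also have "\<dots> \<le> exp (x * C)"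
      using C[of S] T assms by (auto simp: S_def intro!: mult_left_mono)
    finally show ?thesis .
  qed
  then show ?case by blast
qed

text \<open>Over all finite trees this would be the functional equation y = q e^y of the generating
  function. The inequality for finite sets of trees avoids any prior question of
  convergence.\<close>

lemma sum_weight_le:
  fixes q :: real
  assumes "0 \<le> q" "finite S" "finite L" "L \<subseteq> lists S"
  shows "(\<Sum>ts\<in>L. weight q (Node ts)) \<le> q * exp (\<Sum>t\<in>S. weight q t)"
proof -
  have "(\<Sum>ts\<in>L. 1 ^ length ts / fact (length ts) * (\<Prod>i<length ts. weight q (ts ! i))) \<le> exp (1 * sum (weight q) S)"
    using assms by (intro sum_lists_le_exp weight_nonneg) auto
  then have "q * (\<Sum>ts\<in>L. 1 / fact (length ts) * (\<Prod>i<length ts. weight q (ts ! i))) \<le> q * exp (sum (weight q) S)"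
    using assms(1) by (intro mult_left_mono) auto
  then show ?thesis unfolding sum_distrib_left weight.simps .
qed

text \<open>
  The generating function of all finite trees has radius of convergence \<open>exp (- 1)\<close>, where the map
  \<open>y \<mapsto> q * exp y\<close> touches the diagonal at \<open>y = 1\<close>. Avoiding \<open>U\<close> lowers that map by
  \<open>weight q U\<close>, which leaves room to increase \<open>q\<close>.
\<close>

lemma avoiding_radius:
  "\<exists>q > exp (- 1). \<forall>T. finite T \<longrightarrow> (\<forall>t\<in>T. avoids U t) \<longrightarrow> (\<Sum>t\<in>T. weight q t) \<le> (1 :: real)"
proof -
  \<comment> \<open>The iterate \<open>y n q\<close> will bound the total weight of the trees of
    size below \<open>n\<close>. At q = e^(-1) the iterates stay below the fixed point 1.\<close>
  define y where "y n q = ((\<lambda>s. q * exp s) ^^ n) 0" for n and q :: real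
  have y_Suc: "y (Suc n) q = q * exp (y n q)" for n q by (simp add: y_def)
  have y_less: "y n (exp (- 1)) < 1" for n
  proof (induction n)
    case (Suc n)
    then show ?case by (simp add: y_Suc flip: exp_add)
  qed (simp add: y_def)
  have cont_y: "isCont (y n) q" for n q
  proof (induction n)
    case (Suc n)
    then show ?case unfolding y_Suc[abs_def] by (intro continuous_intros)
  qed (simp add: y_def[abs_def])
  have "\<forall>\<^sub>F q in at_right (exp (- 1)). y n q < 1" for n
    using cont_y[where n = n and q = "exp (- 1)"]
    by (intro order_tendstoD(2)[OF _ y_less]) (auto simp: isCont_def intro: tendsto_within_subset)
  \<comment> \<open>For any q > e^(-1) the iterates tend to infinity, so continuity can serve only
    finitely many \<open>n\<close>. It has to reach the size of \<open>U\<close>; beyond that the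
    loss caused by \<open>U\<close> takes over.\<close>
  then have "\<forall>\<^sub>F q in at_right (exp (- 1)). \<forall>n\<in>{..Suc (size U)}. y n q < 1"
    by (intro eventually_ball_finite) auto
  moreover have "\<forall>\<^sub>F q in at_right (exp (- 1)). q * exp 1 - weight q U < (1 :: real)"
  proof (rule order_tendstoD(2))
    have "isCont (\<lambda>q :: real. q * exp 1 - weight q U) (exp (- 1))" by (intro continuous_intros)
    then show "((\<lambda>q. q * exp 1 - weight q U) \<longlongrightarrow> exp (- 1) * exp 1 - weight (exp (- 1)) U) (at_right (exp (- 1 :: real)))"
      by (auto simp: isCont_def intro: tendsto_within_subset)
    show "exp (- 1) * exp 1 - weight (exp (- 1)) U < (1 :: real)"
      using weight_pos[of "exp (- 1)" U] by (simp flip: exp_add)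
  qed
  moreover have "\<forall>\<^sub>F q in at_right (exp (- 1)). q > exp (- 1 :: real)" by (rule eventually_at_right_less)
  ultimately have "\<forall>\<^sub>F q in at_right (exp (- 1)). (\<forall>n\<in>{..Suc (size U)}. y n q < 1) \<and> q * exp 1 - weight q U < 1 \<and> q > exp (- 1)"
    by eventually_elim auto
  then obtain q where q: "\<And>n. n \<le> Suc (size U) \<Longrightarrow> y n q < 1" "q * exp 1 - weight q U < 1" "q > exp (- 1)"
    using eventually_happens by fastforce
  have q0: "q \<ge> 0" using q(3) exp_gt_zero[of "- 1 :: real"] by linarith
  have kid_size: "size t' < n" if "t' \<in> set (kids t)" "size t < Suc n" for t t' n
    using that size_list_estimation'[of t' "kids t" "size t'" size] by (cases t) auto
  have kid_avoids: "avoids U t'" if "t' \<in> set (kids t)" "avoids U t" for t t'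
    using that by (cases t) (auto simp: in_set_conv_nth)
  have small: "(\<Sum>t\<in>T. weight q t) \<le> y n q" if "finite T" "\<And>t. t \<in> T \<Longrightarrow> size t < n" for T n
    using that
  proof (induction n arbitrary: T)
    case 0
    then have "T = {}" by blast
    then show ?case by (simp add: y_def)
  next
    case (Suc n)
    let ?S = "\<Union>ts\<in>kids ` T. set ts"
    have "(\<Sum>t\<in>?S. weight q t) \<le> y n q" using Suc.prems kid_size by (intro Suc.IH) auto
    then have "q * exp (\<Sum>t\<in>?S. weight q t) \<le> q * exp (y n q)" using q0 by (intro mult_left_mono) auto
    moreover have "(\<Sum>ts\<in>kids ` T. weight q (Node ts)) \<le> q * exp (\<Sum>t\<in>?S. weight q t)"
      by (rule sum_weight_le) (use Suc.prems(1) q0 in \<open>auto simp: in_lists_conv_set\<close>)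
    ultimately show ?case unfolding y_Suc sum_kids[OF Suc.prems(1)] by linarith
  qed
  have "(\<Sum>t\<in>T. weight q t) \<le> 1" if "finite T" "\<And>t. t \<in> T \<Longrightarrow> avoids U t" "\<And>t. t \<in> T \<Longrightarrow> size t < n" for T n
    using that
  proof (induction n arbitrary: T)
    case 0
    then have "T = {}" by blast
    then show ?case by simp
  next
    case (Suc n)
    show ?case
    proof (cases "n \<le> size U")
      case True
      have "(\<Sum>t\<in>T. weight q t) \<le> y (Suc n) q" by (rule small) (use Suc.prems in auto)
      then show ?thesis using q(1)[of "Suc n"] True by simp
    next
      case False
      \<comment> \<open>\<open>U\<close> is added to \<open>T\<close> although it does not avoid
        itself: its children do, so the induction hypothesis still covers all children. The bound
        \<open>q * exp 1\<close> then includes the weight of \<open>U\<close>, which can be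
        subtracted.\<close>
      let ?S = "(\<Union>ts\<in>kids ` insert U T. set ts)"
      have U: "U \<notin> T" using Suc.prems(2) by (metis avoids.simps tree.collapse)
      have "avoids U t" if "t \<in> ?S" for t
        using that kid_avoids Suc.prems(2) avoids_children[of U "kids U" t] by auto
      then have "(\<Sum>t\<in>?S. weight q t) \<le> 1"
        using Suc.prems False kid_size by (intro Suc.IH) auto
      then have "q * exp (\<Sum>t\<in>?S. weight q t) \<le> q * exp 1" using q0 by (intro mult_left_mono) auto
      moreover have "(\<Sum>t\<in>insert U T. weight q t) \<le> q * exp (\<Sum>t\<in>?S. weight q t)"
        unfolding sum_kids[OF finite.insertI[OF Suc.prems(1)]]
        by (rule sum_weight_le) (use Suc.prems(1) q0 in \<open>auto simp: in_lists_conv_set\<close>)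
      ultimately show ?thesis using q(2) Suc.prems(1) U by simp
    qed
  qed
  moreover have "\<exists>n. \<forall>t\<in>T. size t < n" if "finite T" for T :: "tree set"
    using finite_nat_set_iff_bounded[of "size ` T"] that by auto
  ultimately have "\<forall>T. finite T \<longrightarrow> (\<forall>t\<in>T. avoids U t) \<longrightarrow> (\<Sum>t\<in>T. weight q t) \<le> 1" by metis
  then show ?thesis using q(3) by blast
qed

text \<open>The convex function exp (c (x - 1)) - x - \<delta> vanishes at \<open>x1\<close> and
  equals -\<delta> < 0 at 1, so it is negative in between and at 1. For \<delta> = 0 this breaks
  down: if c > 1, both 1 and the extinction probability are roots. Below, \<open>u\<close> is the
  coordinate of \<open>x2\<close> on the segment from \<open>x1\<close> to 1.\<close>

lemma fixed_point_unique:
  fixes x1 x2 c \<delta> :: real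
  assumes x: "x1 \<le> x2" "x2 \<le> 1" and \<delta>: "0 < \<delta>"
    and eq: "x1 = exp (c * (x1 - 1)) - \<delta>" "x2 = exp (c * (x2 - 1)) - \<delta>"
  shows "x1 = x2"
proof (rule ccontr)
  assume "x1 \<noteq> x2"
  then have lt: "x1 < x2" "x1 < 1" using x by auto
  define u where "u = (x2 - x1) / (1 - x1)"
  have u: "0 < u" "u \<le> 1" "u * (1 - x1) = x2 - x1" using lt x by (auto simp: u_def)
  have a: "exp ((1 - u) *\<^sub>R (c * (x1 - 1)) + u *\<^sub>R 0) \<le> (1 - u) * exp (c * (x1 - 1)) + u * exp 0"
    using u by (intro convex_onD[OF exp_convex]) auto
  have b: "(1 - u) *\<^sub>R (c * (x1 - 1)) + u *\<^sub>R 0 = c * (x2 - 1)"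
  proof -
    have "(1 - u) * (c * (x1 - 1)) = c * (x1 - 1) + c * (u * (1 - x1))" by algebra
    then show ?thesis unfolding u(3) by (simp add: algebra_simps)
  qed
  have "exp (c * (x1 - 1)) = x1 + \<delta>" "exp (c * (x2 - 1)) = x2 + \<delta>" using eq by auto
  with a[unfolded b] have "x2 + \<delta> \<le> (1 - u) * (x1 + \<delta>) + u" by simp
  also have "\<dots> = x2 + (1 - u) * \<delta>" using u(3) by (simp add: algebra_simps)
  finally have "u * \<delta> \<le> 0" by (simp add: algebra_simps)
  then show False using u \<delta> by (simp add: mult_le_0_iff)
qed

text \<open>Conditioning on the number of children gives the probability generating function of the
  Poisson distribution.\<close>

lemma prob_all_children:
  assumes "c > 0" and E [measurable]: "Measurable.pred (gw_space c) E"
  shows "\<P>(z in gw_space c. \<forall>i<z []. E (branch i z)) = exp (c * (\<P>(z in gw_space c. E z) - 1))"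
proof -
  interpret prob_space "gw_space c" by (rule prob_space_gw_space)
  let ?p = "\<P>(z in gw_space c. E z)"
  let ?A = "\<lambda>n. {z \<in> space (gw_space c). z [] = n \<and> (\<forall>i<n. E (branch i z))}"
  have "?A n \<in> events" for n by measurable
  then have "(\<lambda>n. prob (?A n)) sums prob (\<Union>n. ?A n)"
    by (intro finite_measure_UNION) (auto simp: disjoint_family_on_def simp del: space_gw_space)
  moreover have "(\<Union>n. ?A n) = {z \<in> space (gw_space c). \<forall>i<z []. E (branch i z)}" by auto
  moreover have "prob (?A n) = exp (- c) * ((c * ?p) ^ n /\<^sub>R fact n)" for n
    using prob_root_branches[where c = c and n = n and E = "\<lambda>_. E"] assms
    by (simp add: power_mult_distrib divide_inverse)
  ultimately have "(\<lambda>n. exp (- c) * ((c * ?p) ^ n /\<^sub>R fact n)) sums \<P>(z in gw_space c. \<forall>i<z []. E (branch i z))"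
    by simp
  moreover have "(\<lambda>n. exp (- c) * ((c * ?p) ^ n /\<^sub>R fact n)) sums (exp (- c) * exp (c * ?p))"
    by (intro sums_mult exp_converges)
  ultimately show ?thesis using sums_unique2 by (fastforce simp: algebra_simps simp flip: exp_add)
qed

text \<open>"All branches satisfy \<open>E\<close>" is the disjoint union of \<open>E\<close> and of
  being \<open>U\<close>. It is stated for a general \<open>E\<close> because both avoiding
  \<open>U\<close> and avoiding \<open>U\<close> while being finite satisfy the hypotheses.\<close>

lemma prob_avoiding_recursion:
  assumes "c > 0" and E [measurable]: "Measurable.pred (gw_space c) E"
    and rec: "\<And>z. E z \<longleftrightarrow> \<not> matches z U \<and> (\<forall>i<z []. E (branch i z))"
    and branch: "\<And>z. matches z U \<Longrightarrow> \<forall>i<z []. E (branch i z)"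
  shows "\<P>(z in gw_space c. E z)
    = exp (c * (\<P>(z in gw_space c. E z) - 1)) - \<P>(z in gw_space c. matches z U)"
proof -
  interpret prob_space "gw_space c" by (rule prob_space_gw_space)
  have "{z \<in> space (gw_space c). \<forall>i<z []. E (branch i z)}
      = {z \<in> space (gw_space c). E z} \<union> {z \<in> space (gw_space c). matches z U}"
    using rec branch by blast
  moreover have "{z \<in> space (gw_space c). E z} \<inter> {z \<in> space (gw_space c). matches z U} = {}"
    using rec by blast
  moreover have "{z \<in> space (gw_space c). E z} \<in> events" "{z \<in> space (gw_space c). matches z U} \<in> events"
    by measurable
  ultimately have "\<P>(z in gw_space c. \<forall>i<z []. E (branch i z))
      = \<P>(z in gw_space c. E z) + \<P>(z in gw_space c. matches z U)"
    using finite_measure_Union by simp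
  then show ?thesis using prob_all_children[OF assms(1) E] by simp
qed

definition finite_tree :: "(nat list \<Rightarrow> nat) \<Rightarrow> bool" where
  "finite_tree z \<longleftrightarrow> (\<exists>t. matches z t)"

lemma finite_tree_rec: "finite_tree z \<longleftrightarrow> (\<forall>i<z []. finite_tree (branch i z))"
proof
  assume "finite_tree z"
  then obtain ts where "matches z (Node ts)" unfolding finite_tree_def by (metis tree.collapse)
  then show "\<forall>i<z []. finite_tree (branch i z)" by (auto simp: finite_tree_def)
next
  assume "\<forall>i<z []. finite_tree (branch i z)"
  then obtain f where "\<forall>i<z []. matches (branch i z) (f i)" unfolding finite_tree_def by metis
  then have "matches z (Node (map f [0..<z []]))" by simp
  then show "finite_tree z" unfolding finite_tree_def by blast
qed

lemma finite_tree_measurable [measurable]: "Measurable.pred (gw_space c) finite_tree"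
  unfolding finite_tree_def[abs_def] by measurable

lemma matches_children_avoid:
  assumes "matches z U" "i < z []"
  shows "finite_tree (branch i z) \<and> \<not> has_copy U (branch i z)"
proof -
  obtain us where U: "U = Node us" by (cases U)
  then have m: "matches (branch i z) (us ! i)" and "i < length us" using assms by auto
  then have "avoids U (us ! i)" using avoids_children[OF U] by simp
  then show ?thesis using avoids_iff[OF m] m by (auto simp: finite_tree_def)
qed

text \<open>
  The events that \<open>U\<close> is avoided, and that \<open>U\<close> is avoided by a finite tree, have probabilities that
  solve the same fixed point equation, which has only one solution.
\<close>

lemma prob_infinite_avoiding:
  assumes "c > 0"
  shows "\<P>(z in gw_space c. \<not> has_copy U z \<and> \<not> finite_tree z) = 0"
proof -
  interpret prob_space "gw_space c" by (rule prob_space_gw_space)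
  let ?E1 = "\<lambda>z. finite_tree z \<and> \<not> has_copy U z" and ?E2 = "\<lambda>z. \<not> has_copy U z"
  have 1: "prob {z \<in> space (gw_space c). ?E1 z} = exp (c * (prob {z \<in> space (gw_space c). ?E1 z} - 1))
      - prob {z \<in> space (gw_space c). matches z U}"
  proof (rule prob_avoiding_recursion[OF assms])
    show "?E1 z \<longleftrightarrow> \<not> matches z U \<and> (\<forall>i<z []. ?E1 (branch i z))" for z
      using has_copy_rec[of U z] finite_tree_rec[of z] by blast
  qed (use matches_children_avoid in auto)
  have 2: "prob {z \<in> space (gw_space c). ?E2 z} = exp (c * (prob {z \<in> space (gw_space c). ?E2 z} - 1))
      - prob {z \<in> space (gw_space c). matches z U}"
  proof (rule prob_avoiding_recursion[OF assms])
    show "?E2 z \<longleftrightarrow> \<not> matches z U \<and> (\<forall>i<z []. ?E2 (branch i z))" for z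
      using has_copy_rec[of U z] by blast
  qed (use matches_children_avoid in auto)
  have m: "{z \<in> space (gw_space c). ?E1 z} \<in> events" "{z \<in> space (gw_space c). ?E2 z} \<in> events"
    by measurable
  have pos: "0 < prob {z \<in> space (gw_space c). matches z U}"
    using prob_matches[OF assms, of U] weight_pos[of "c * exp (- c)" U] assms
    by (metis exp_gt_zero mult_pos_pos zero_less_mult_pos)
  have "prob {z \<in> space (gw_space c). ?E1 z} = prob {z \<in> space (gw_space c). ?E2 z}"
    by (rule fixed_point_unique[OF _ _ pos 1 2]) (auto intro!: finite_measure_mono m simp del: space_gw_space)
  moreover have "{z \<in> space (gw_space c). \<not> has_copy U z \<and> \<not> finite_tree z}
      = {z \<in> space (gw_space c). ?E2 z} - {z \<in> space (gw_space c). ?E1 z}" by auto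
  moreover have "prob ({z \<in> space (gw_space c). ?E2 z} - {z \<in> space (gw_space c). ?E1 z})
      = prob {z \<in> space (gw_space c). ?E2 z} - prob {z \<in> space (gw_space c). ?E1 z}"
    by (rule finite_measure_Diff[OF m(2,1)]) auto
  ultimately show ?thesis by simp
qed

section \<open>Probabilities as sums over finite trees\<close>

lemma prob_countable_sum:
  fixes f :: "(nat list \<Rightarrow> nat) \<Rightarrow> 'a :: countable \<Rightarrow> bool"
  assumes [measurable]: "\<And>t. Measurable.pred (gw_space c) (\<lambda>z. f z t)"
    and "\<And>z t t'. f z t \<Longrightarrow> f z t' \<Longrightarrow> t = t'"
  shows "((\<lambda>t. \<P>(z in gw_space c. f z t)) has_sum \<P>(z in gw_space c. \<exists>t\<in>S. f z t)) S"
proof -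
  interpret prob_space "gw_space c" by (rule prob_space_gw_space)
  let ?A = "\<lambda>n :: nat. {z \<in> space (gw_space c). \<exists>t\<in>S. to_nat t = n \<and> f z t}"
  have meas: "?A n \<in> events" for n by measurable
  have disj: "disjoint_family ?A" using assms(2) by (fastforce simp: disjoint_family_on_def)
  have U: "(\<Union>n. ?A n) = {z \<in> space (gw_space c). \<exists>t\<in>S. f z t}" by auto
  have "(\<lambda>n. prob (?A n)) sums prob (\<Union>n. ?A n)"
    using meas disj by (intro finite_measure_UNION) auto
  then have "((\<lambda>n. prob (?A n)) has_sum prob (\<Union>n. ?A n)) UNIV"
    by (intro sums_nonneg_imp_has_sum) auto
  \<comment> \<open>Numbers that code no element of \<open>S\<close> index empty events, so
    restricting the index set does not change the sum.\<close>
  then have "((\<lambda>n. prob (?A n)) has_sum prob (\<Union>n. ?A n)) (to_nat ` S)"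
    by (rule has_sum_cong_neutral[THEN iffD1, rotated -1]) (auto simp: image_iff intro!: arg_cong[of _ "{}" prob, simplified])
  then have "((\<lambda>t. prob (?A (to_nat t))) has_sum prob (\<Union>n. ?A n)) S"
    by (subst (asm) has_sum_reindex) (auto simp: inj_on_def o_def)
  moreover have "?A (to_nat t) = {z \<in> space (gw_space c). f z t}" if "t \<in> S" for t using that by auto
  ultimately show ?thesis unfolding U by (simp cong: has_sum_cong)
qed

text \<open>The hypothesis on \<open>Q\<close> says that for finite trees \<open>Q\<close> depends
  only on the tree matched by \<open>z\<close>, so the event splits into countably many disjoint
  events "the tree is t".\<close>

lemma prob_finite_avoiding:
  assumes "c > 0" and Q: "\<And>z z' t. matches z t \<Longrightarrow> matches z' t \<Longrightarrow> Q z \<Longrightarrow> Q z'"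
  shows "c * \<P>(z in gw_space c. Q z \<and> finite_tree z \<and> \<not> has_copy U z)
    = (\<Sum>\<^sub>\<infinity>t\<in>{t. avoids U t \<and> (\<exists>z. matches z t \<and> Q z)}. weight (c * exp (- c)) t)"
proof -
  let ?S = "{t. avoids U t \<and> (\<exists>z. matches z t \<and> Q z)}"
  have "((\<lambda>t. c * \<P>(z in gw_space c. matches z t)) has_sum c * \<P>(z in gw_space c. \<exists>t\<in>?S. matches z t)) ?S"
    by (intro has_sum_cmult_right prob_countable_sum) (auto dest: matches_unique)
  moreover have "(\<exists>t\<in>?S. matches z t) \<longleftrightarrow> Q z \<and> finite_tree z \<and> \<not> has_copy U z" for z
    unfolding finite_tree_def using Q avoids_iff by blast
  ultimately have "((\<lambda>t. weight (c * exp (- c)) t) has_sum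
      c * \<P>(z in gw_space c. Q z \<and> finite_tree z \<and> \<not> has_copy U z)) ?S"
    by (simp only: prob_matches[OF assms(1)])
  then show ?thesis by (rule infsumI[symmetric])
qed

lemma prob_trunc_in:
  assumes "c > 0"
  shows "\<P>(z in gw_space c. trunc d z \<in> B) = (\<Sum>\<^sub>\<infinity>t\<in>B. trunc_weight d (exp (- c)) c t)"
proof -
  have "((\<lambda>t. \<P>(z in gw_space c. trunc d z = t)) has_sum \<P>(z in gw_space c. \<exists>t\<in>B. trunc d z = t)) B"
    by (rule prob_countable_sum) auto
  moreover have "(\<exists>t\<in>B. trunc d z = t) \<longleftrightarrow> trunc d z \<in> B" for z by simp
  ultimately have "((\<lambda>t. trunc_weight d (exp (- c)) c t) has_sum \<P>(z in gw_space c. trunc d z \<in> B)) B"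
    by (simp only: prob_trunc[OF assms])
  then show ?thesis by (rule infsumI[symmetric])
qed

lemma prob_split:
  assumes "c > 0" and Q [measurable]: "Measurable.pred (gw_space c) Q"
  shows "\<P>(z in gw_space c. Q z)
    = \<P>(z in gw_space c. Q z \<and> has_copy U z) + \<P>(z in gw_space c. Q z \<and> finite_tree z \<and> \<not> has_copy U z)"
proof -
  interpret prob_space "gw_space c" by (rule prob_space_gw_space)
  let ?A = "{z \<in> space (gw_space c). Q z \<and> has_copy U z}"
  let ?B = "{z \<in> space (gw_space c). Q z \<and> finite_tree z \<and> \<not> has_copy U z}"
  let ?C = "{z \<in> space (gw_space c). Q z \<and> \<not> finite_tree z \<and> \<not> has_copy U z}"
  let ?N = "{z \<in> space (gw_space c). \<not> has_copy U z \<and> \<not> finite_tree z}"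
  have m: "?A \<in> events" "?B \<in> events" "?C \<in> events" "?N \<in> events" by measurable
  have "prob ?C \<le> prob ?N" by (intro finite_measure_mono m(4)) auto
  then have "prob ?C = 0" using prob_infinite_avoiding[OF assms(1), of U] measure_nonneg[of "gw_space c" ?C] by linarith
  moreover have "prob (?A \<union> (?B \<union> ?C)) = prob ?A + (prob ?B + prob ?C)"
    by (subst finite_measure_Union[OF m(1) sets.Un[OF m(2,3)]], blast)
       (subst finite_measure_Union[OF m(2,3)], auto)
  moreover have "{z \<in> space (gw_space c). Q z} = ?A \<union> (?B \<union> ?C)" by blast
  ultimately show ?thesis by simp
qed

lemma matches_eq_trunc: "matches z t \<Longrightarrow> matches z' t \<Longrightarrow> trunc d z = trunc d z'"
proof (induction d arbitrary: z z' t)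
  case (Suc d)
  obtain ts where t: "t = Node ts" by (cases t)
  have "trunc d (branch i z) = trunc d (branch i z')" if "i < length ts" for i
    by (rule Suc.IH[of _ "ts ! i"]) (use Suc.prems that t in auto)
  then show ?case using Suc.prems t by simp
qed simp

text \<open>In the presence of \<open>U\<close>, the sentence is equivalent to membership of the
  truncation in \<open>B\<close>. Splitting both events according to whether \<open>U\<close> occurs
  and subtracting cancels the parts with a copy of \<open>U\<close>, which have no direct
  description; the event on the truncation and two sums over avoiding finite trees remain.\<close>

lemma gw_prob_decomposition:
  obtains U d S1 S2 B where "S1 \<subseteq> {t. avoids U t}" "S2 \<subseteq> {t. avoids U t}"
    "\<And>c. c > 0 \<Longrightarrow> gw_prob A c =
      (\<Sum>\<^sub>\<infinity>t\<in>S1. weight (c * exp (- c)) t) / c - (\<Sum>\<^sub>\<infinity>t\<in>S2. weight (c * exp (- c)) t) / c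
      + (\<Sum>\<^sub>\<infinity>t\<in>B. trunc_weight d (exp (- c)) c t)"
proof -
  obtain U d where det: "\<And>z z'. has_copy U z \<Longrightarrow> has_copy U z' \<Longrightarrow> trunc d z = trunc d z' \<Longrightarrow>
      gw_models z A = gw_models z' A"
    using models_determined[of A] by blast
  define B where "B = trunc d ` {z. has_copy U z \<and> gw_models z A}"
  define S where "S Q = {t. avoids U t \<and> (\<exists>z. matches z t \<and> Q z)}" for Q
  have decomp: "gw_prob A c = (\<Sum>\<^sub>\<infinity>t\<in>S (\<lambda>z. gw_models z A). weight (c * exp (- c)) t) / c
      - (\<Sum>\<^sub>\<infinity>t\<in>S (\<lambda>z. trunc d z \<in> B). weight (c * exp (- c)) t) / c
      + (\<Sum>\<^sub>\<infinity>t\<in>B. trunc_weight d (exp (- c)) c t)" if c: "c > 0" for c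
  proof -
    have [measurable]: "Measurable.pred (gw_space c) (\<lambda>z. gw_models z A)"
      using gw_models_measurable by (simp add: pred_def)
    have "gw_models z' A" if "matches z t" "matches z' t" "gw_models z A" for z z' t
    proof -
      have "gw_verts z = gw_verts z'" using matches_eq_in_tree[OF that(1,2)] by (auto simp: gw_verts_def)
      then show ?thesis using that(3) by (simp add: gw_models_def)
    qed
    then have 1: "c * \<P>(z in gw_space c. gw_models z A \<and> finite_tree z \<and> \<not> has_copy U z)
        = (\<Sum>\<^sub>\<infinity>t\<in>S (\<lambda>z. gw_models z A). weight (c * exp (- c)) t)"
      unfolding S_def by (intro prob_finite_avoiding[OF c]) blast
    have "trunc d z' \<in> B" if "matches z t" "matches z' t" "trunc d z \<in> B" for z z' t
      using matches_eq_trunc[OF that(1,2), of d] that(3) by simp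
    then have 2: "c * \<P>(z in gw_space c. trunc d z \<in> B \<and> finite_tree z \<and> \<not> has_copy U z)
        = (\<Sum>\<^sub>\<infinity>t\<in>S (\<lambda>z. trunc d z \<in> B). weight (c * exp (- c)) t)"
      unfolding S_def by (intro prob_finite_avoiding[OF c]) blast
    have "gw_models z A \<and> has_copy U z \<longleftrightarrow> trunc d z \<in> B \<and> has_copy U z" for z
    proof
      assume "trunc d z \<in> B \<and> has_copy U z"
      then obtain z' where "trunc d z = trunc d z'" "has_copy U z'" "gw_models z' A" "has_copy U z"
        by (auto simp: B_def)
      then show "gw_models z A \<and> has_copy U z" using det[of z z'] by simp
    qed (simp add: B_def)
    then have "\<P>(z in gw_space c. gw_models z A \<and> has_copy U z) = \<P>(z in gw_space c. trunc d z \<in> B \<and> has_copy U z)"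
      by simp
    moreover have "gw_prob A c = \<P>(z in gw_space c. gw_models z A \<and> has_copy U z)
        + \<P>(z in gw_space c. gw_models z A \<and> finite_tree z \<and> \<not> has_copy U z)"
      unfolding gw_prob_def by (rule prob_split[OF c]) measurable
    moreover have "\<P>(z in gw_space c. trunc d z \<in> B) = \<P>(z in gw_space c. trunc d z \<in> B \<and> has_copy U z)
        + \<P>(z in gw_space c. trunc d z \<in> B \<and> finite_tree z \<and> \<not> has_copy U z)"
      by (rule prob_split[OF c]) measurable
    moreover have "p = s / c" if "c * p = s" for p s :: real
      using that c by (auto simp: field_simps)
    note this[OF 1] this[OF 2]
    ultimately show ?thesis unfolding prob_trunc_in[OF c] by linarith
  qed
  have "S Q \<subseteq> {t. avoids U t}" for Q by (auto simp: S_def)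
  from that[OF this this decomp] show thesis .
qed

section \<open>Holomorphic extension\<close>

text \<open>The Weierstrass M-test for an unordered sum, combined with the holomorphy of locally
  uniform limits.\<close>

lemma holomorphic_on_infsum:
  fixes f :: "'a \<Rightarrow> complex \<Rightarrow> complex"
  assumes S: "open S" and hol: "\<And>t. t \<in> A \<Longrightarrow> f t holomorphic_on S"
    and bound: "\<And>t x. t \<in> A \<Longrightarrow> x \<in> S \<Longrightarrow> norm (f t x) \<le> M t" and M: "M summable_on A"
  shows "(\<lambda>x. \<Sum>\<^sub>\<infinity>t\<in>A. f t x) holomorphic_on S"
proof -
  have unif: "uniform_limit S (\<lambda>F x. \<Sum>t\<in>F. f t x) (\<lambda>x. \<Sum>\<^sub>\<infinity>t\<in>A. f t x) (finite_subsets_at_top A)"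
    unfolding uniform_limit_iff
  proof (intro allI impI)
    fix e :: real assume e: "e > 0"
    have "((\<lambda>F. sum M F) \<longlongrightarrow> infsum M A) (finite_subsets_at_top A)"
      using M by (rule infsum_tendsto)
    then have "\<forall>\<^sub>F F in finite_subsets_at_top A. dist (sum M F) (infsum M A) < e"
      using e by (rule tendstoD)
    moreover have "\<forall>\<^sub>F F in finite_subsets_at_top A. finite F \<and> F \<subseteq> A"
      by (intro eventually_finite_subsets_at_top_weakI) auto
    ultimately show "\<forall>\<^sub>F F in finite_subsets_at_top A. \<forall>x\<in>S. dist (\<Sum>t\<in>F. f t x) (\<Sum>\<^sub>\<infinity>t\<in>A. f t x) < e"
    proof eventually_elim
      case (elim F)
      show ?case
      proof
        fix x assume x: "x \<in> S"
        have abs: "(\<lambda>t. norm (f t x)) summable_on A"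
          by (rule Infinite_Sum.abs_summable_on_comparison_test'[OF M]) (rule bound[OF _ x])
        then have sm: "(\<lambda>t. f t x) summable_on A" by (rule Infinite_Sum.abs_summable_summable)
        have absD: "(\<lambda>t. norm (f t x)) summable_on (A - F)" and MD: "M summable_on (A - F)"
          using abs M by (auto intro: summable_on_subset_banach)
        have "(\<Sum>\<^sub>\<infinity>t\<in>A. f t x) - (\<Sum>t\<in>F. f t x) = (\<Sum>\<^sub>\<infinity>t\<in>A - F. f t x)"
          using elim sm by (subst infsum_Diff) (auto intro: summable_on_finite)
        also have "norm \<dots> \<le> (\<Sum>\<^sub>\<infinity>t\<in>A - F. norm (f t x))" by (rule norm_infsum_bound[OF absD])
        also have "\<dots> \<le> infsum M (A - F)" using bound x by (intro infsum_mono[OF absD MD]) auto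
        also have "\<dots> = infsum M A - sum M F"
          using elim M by (subst infsum_Diff) (auto intro: summable_on_finite)
        also have "\<dots> < e" using elim by (auto simp: dist_real_def)
        finally show "dist (\<Sum>t\<in>F. f t x) (\<Sum>\<^sub>\<infinity>t\<in>A. f t x) < e" by (simp add: dist_norm norm_minus_commute)
      qed
    qed
  qed
  have "(\<lambda>x. \<Sum>\<^sub>\<infinity>t\<in>A. f t x) field_differentiable at z" if z: "z \<in> S" for z
  proof -
    obtain r where r: "r > 0" "cball z r \<subseteq> S" using S z open_contains_cball by blast
    have fin: "\<forall>\<^sub>F F in finite_subsets_at_top A. finite F \<and> F \<subseteq> A"
      by (intro eventually_finite_subsets_at_top_weakI) auto
    have "\<forall>\<^sub>F F in finite_subsets_at_top A. continuous_on (cball z r) (\<lambda>x. \<Sum>t\<in>F. f t x)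
        \<and> (\<lambda>x. \<Sum>t\<in>F. f t x) holomorphic_on ball z r"
      using fin
    proof eventually_elim
      case (elim F)
      have "(\<lambda>x. \<Sum>t\<in>F. f t x) holomorphic_on S" using elim hol by (intro holomorphic_intros) auto
      then show ?case using r(2) by (meson ball_subset_cball holomorphic_on_imp_continuous_on holomorphic_on_subset order_trans)
    qed
    then have "(\<lambda>x. \<Sum>\<^sub>\<infinity>t\<in>A. f t x) holomorphic_on ball z r"
      by (rule holomorphic_uniform_limit[OF _ uniform_limit_on_subset[OF unif r(2)]]) auto
    then show ?thesis using r(1) by (intro holomorphic_on_imp_differentiable_at[of _ "ball z r"]) auto
  qed
  then show ?thesis by (auto simp: holomorphic_on_def intro: field_differentiable_at_within)
qed

lemma infsum_of_real:
  "(\<Sum>\<^sub>\<infinity>t\<in>A. complex_of_real (f t)) = of_real (\<Sum>\<^sub>\<infinity>t\<in>A. f t)"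
proof (cases "f summable_on A")
  case True
  then show ?thesis by (intro infsumI has_sum_of_real has_sum_infsum)
next
  case False
  \<comment> \<open>Without summability both infinite sums have the default value 0.\<close>
  then have "\<not> (\<lambda>t. complex_of_real (f t)) summable_on A" using summable_on_Re[of "\<lambda>t. complex_of_real (f t)" A] by auto
  with False show ?thesis by (simp add: infsum_not_exists)
qed

text \<open>Along the real axis, the derivative of the real part of a holomorphic function is the
  real part of its complex derivative. The identity for the k-th derivatives is carried on all of
  the open set \<open>R\<close>, since differentiating it once more needs a neighbourhood.\<close>

lemma smooth_real_part:
  fixes f :: "real \<Rightarrow> real"
  assumes S: "open S" and F: "F holomorphic_on S" and f: "\<And>x. complex_of_real x \<in> S \<Longrightarrow> f x = Re (F (of_real x))"
    and x: "complex_of_real x \<in> S"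
  shows "(deriv ^^ k) f field_differentiable (at x)"
proof -
  define R where "R = {x. complex_of_real x \<in> S}"
  have R: "open R" using open_vimage[OF S continuous_on_of_real_id] by (simp add: R_def vimage_def)
  have der: "(g has_real_derivative Re (deriv G (of_real x))) (at x)"
    if "G holomorphic_on S" "\<And>x. x \<in> R \<Longrightarrow> g x = Re (G (of_real x))" "x \<in> R" for g G and x
  proof -
    have "(G has_field_derivative deriv G (of_real x)) (at (of_real x))"
      using that(1,3) S by (auto simp: R_def intro: holomorphic_derivI)
    then have "((\<lambda>x. G (of_real x)) has_vector_derivative deriv G (of_real x)) (at x)"
      by (rule has_vector_derivative_real_field)
    then have "((\<lambda>x. Re (G (of_real x))) has_vector_derivative Re (deriv G (of_real x))) (at x)"
      by (rule bounded_linear.has_vector_derivative[OF bounded_linear_Re])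
    then have "((\<lambda>x. Re (G (of_real x))) has_real_derivative Re (deriv G (of_real x))) (at x)"
      by (simp add: has_real_derivative_iff_has_vector_derivative)
    then show ?thesis
      by (rule has_field_derivative_transform_within_open[OF _ R that(3)]) (use that(2) in auto)
  qed
  have hol: "(deriv ^^ k) F holomorphic_on S" for k
    by (rule holomorphic_higher_deriv[OF F S])
  have eq: "(deriv ^^ k) f x = Re ((deriv ^^ k) F (of_real x))" if "x \<in> R" for k x
    using that
  proof (induction k arbitrary: x)
    case 0
    then show ?case using f by (simp add: R_def)
  next
    case (Suc k)
    show ?case using DERIV_imp_deriv[OF der[OF hol Suc.IH Suc.prems]] by simp
  qed
  show ?thesis
    using der[OF hol eq, of x k] x unfolding field_differentiable_def R_def by blast
qed

theorem theorem2p2: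
  fixes A :: tree_formula
  assumes "sentence A"
  shows "\<forall>k. \<forall>c>0. (deriv ^^ k) (gw_prob A) field_differentiable (at c)
                 \<and> isCont ((deriv ^^ k) (gw_prob A)) c"
proof (intro allI impI)
  fix k and c :: real assume c: "c > 0"
  obtain U d S1 S2 B where S: "S1 \<subseteq> {t. avoids U t}" "S2 \<subseteq> {t. avoids U t}" and
    decomp: "\<And>c. c > 0 \<Longrightarrow> gw_prob A c =
      (\<Sum>\<^sub>\<infinity>t\<in>S1. weight (c * exp (- c)) t) / c - (\<Sum>\<^sub>\<infinity>t\<in>S2. weight (c * exp (- c)) t) / c
      + (\<Sum>\<^sub>\<infinity>t\<in>B. trunc_weight d (exp (- c)) c t)"
    by (rule gw_prob_decomposition[of A]) (rule that)
  obtain q :: real where q: "q > exp (- 1)"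
    "\<And>T. finite T \<Longrightarrow> \<forall>t\<in>T. avoids U t \<Longrightarrow> (\<Sum>t\<in>T. weight q t) \<le> 1"
    using avoiding_radius[of U] by blast
  have q0: "q \<ge> 0" using q(1) exp_gt_zero[of "- 1 :: real"] by linarith
  \<comment> \<open>Re \<zeta> > 0 gives |exp (- \<zeta>)| \<le> 1 and keeps the divisor \<zeta>
    away from 0. The bound c + 1 on |\<zeta>| gives a summable majorant for the truncated trees, and
    the bound q one for the avoiding trees.\<close>
  define \<Omega> where "\<Omega> = {\<zeta>. 0 < Re \<zeta> \<and> norm \<zeta> < c + 1 \<and> norm (\<zeta> * exp (- \<zeta>)) < q}"
  have \<Omega>: "open \<Omega>"
    unfolding \<Omega>_def by (intro open_Collect_conj open_Collect_less continuous_intros)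
  define G where "G S \<zeta> = (\<Sum>\<^sub>\<infinity>t\<in>S. weight (\<zeta> * exp (- \<zeta>)) t)" for S and \<zeta> :: complex
  define H where "H \<zeta> = (\<Sum>\<^sub>\<infinity>t\<in>B. trunc_weight d (exp (- \<zeta>)) \<zeta> t)" for \<zeta> :: complex
  have G: "G S holomorphic_on \<Omega>" if "S \<subseteq> {t. avoids U t}" for S
    unfolding G_def
  proof (rule holomorphic_on_infsum[OF \<Omega>])
    show "weight q summable_on S"
      using q(2) that q0 by (intro nonneg_bdd_above_summable_on bdd_aboveI2[where M = 1] weight_nonneg) blast+
    show "norm (weight (\<zeta> * exp (- \<zeta>)) t) \<le> weight q t" if "\<zeta> \<in> \<Omega>" for \<zeta> t
      using that by (auto simp: norm_weight \<Omega>_def intro!: weight_mono)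
  qed (intro holomorphic_intros)
  obtain C where C: "\<And>T. finite T \<Longrightarrow> (\<Sum>t\<in>T. trunc_weight d 1 (c + 1) t) \<le> C"
    using sum_trunc_weight_bounded[of "c + 1" d] c by auto
  have H: "H holomorphic_on \<Omega>"
    unfolding H_def
  proof (rule holomorphic_on_infsum[OF \<Omega>])
    show "trunc_weight d 1 (c + 1) summable_on B"
      using C c by (intro nonneg_bdd_above_summable_on bdd_aboveI2[where M = C] trunc_weight_nonneg) auto
    show "norm (trunc_weight d (exp (- \<zeta>)) \<zeta> t) \<le> trunc_weight d 1 (c + 1) t" if "\<zeta> \<in> \<Omega>" for \<zeta> t
      using that by (intro norm_trunc_weight_le) (auto simp: \<Omega>_def)
  qed (intro holomorphic_intros)
  define F where "F \<zeta> = G S1 \<zeta> / \<zeta> - G S2 \<zeta> / \<zeta> + H \<zeta>" for \<zeta>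
  have hol: "F holomorphic_on \<Omega>"
    unfolding F_def by (intro holomorphic_intros G H S) (auto simp: \<Omega>_def)
  have eq: "gw_prob A x = Re (F (of_real x))" if "complex_of_real x \<in> \<Omega>" for x
  proof -
    have x: "x > 0" using that by (simp add: \<Omega>_def)
    have e: "exp (- complex_of_real x) = of_real (exp (- x))"
      by (metis exp_of_real of_real_minus)
    have "complex_of_real x * exp (- complex_of_real x) = of_real (x * exp (- x))"
      by (simp only: e of_real_mult)
    then have "G S (of_real x) = of_real (\<Sum>\<^sub>\<infinity>t\<in>S. weight (x * exp (- x)) t)" for S
      by (simp only: G_def weight_of_real infsum_of_real)
    moreover have "H (of_real x) = of_real (\<Sum>\<^sub>\<infinity>t\<in>B. trunc_weight d (exp (- x)) x t)"
      by (simp only: H_def e trunc_weight_of_real infsum_of_real)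
    ultimately have "F (of_real x) = of_real (gw_prob A x)"
      using decomp[OF x] by (simp add: F_def)
    then show ?thesis by simp
  qed
  have mem: "complex_of_real c \<in> \<Omega>"
  proof -
    \<comment> \<open>This is c \<le> exp (c - 1). Equality holds only at c = 1, where the strict
      inequality exp (- 1) < q is indispensable.\<close>
    have "c * exp (- c) \<le> exp (c - 1) * exp (- c)"
      using exp_ge_add_one_self[of "c - 1"] by (intro mult_right_mono) auto
    also have "\<dots> = exp (- 1)" by (simp flip: exp_add)
    finally have "c * exp (- c) < q" using q(1) by simp
    then show ?thesis using c by (simp add: \<Omega>_def norm_mult)
  qed
  have "(deriv ^^ k) (gw_prob A) field_differentiable (at c)"
    by (rule smooth_real_part[OF \<Omega> hol eq mem])
  then show "(deriv ^^ k) (gw_prob A) field_differentiable (at c) \<and> isCont ((deriv ^^ k) (gw_prob A)) c"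
    by (simp add: field_differentiable_imp_continuous_at)
qed

end
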